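(* For every non-constant real-analytic $1$-periodic $\varphi:\mathbb R\to\mathbb R$ there is a constant $c(\varphi)>0$, and for every $0<\mu<1$ a constant $\lambda_*(\mu,\varphi)\ge2$, such that for every integer $\lambda\ge\lambda_*(\mu,\varphi)$ $$\sup_{n\in\mathbb Z}\left|\int_0^1 e^{2\pi i n\theta}e^{itW_{\mu,\lambda}(\theta)}\,d\theta\right|\lesssim|t|^{-c(\varphi)\frac{\log\lambda}{|\log\mu|}},\qquad |t|\to\infty,$$ and, with these constants, for every integer $k\ge0$ the local time of $W_{\mu,\lambda}$ exists and is $C^k$ for every integer $$\lambda\ge\max\left\{\lambda_*(\mu,\varphi),\ \exp\!\left(\frac{(k+1)|\log\mu|}{c(\varphi)}\right)\right\}.$$ In particular, this includes the classical sine and cosine Weierstrass functions ($\varphi(\theta)=\sin(2\pi\theta)$ and $\varphi(\theta)=\cos(2\pi\theta)$) for all sufficiently large $\lambda$.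
   Context: For $0<\mu<1$ and an integer $\lambda\ge2$, $W_{\mu,\lambda}(\theta)=\sum_{j=0}^\infty\mu^j\varphi(\lambda^j\theta)$. The occupation measure of $W_{\mu,\lambda}$ is the push-forward $(W_{\mu,\lambda})_*d\theta$ of Lebesgue measure on $[0,1)$; the local time (occupation density) of $W_{\mu,\lambda}$ is the density of this measure with respect to Lebesgue measure on $\mathbb R$, when it exists (it is $C^k$ if it has a $C^k$ version). The implied constant in $\lesssim$ may depend on $\varphi,\mu,\lambda$ but not on $n,t$. *)

theory Defs
  imports "HOL-Analysis.Analysis" "HOL-Library.Landau_Symbols"
begin

definition real_analytic :: "(real \<Rightarrow> real) \<Rightarrow> bool" where
  "real_analytic f \<longleftrightarrow> (\<forall>x. \<exists>F. (\<lambda>h. f (x + h)) has_fps_expansion F)"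

text \<open>The integer frequency ratio, usually written \<open>\<lambda>\<close>, is called \<open>b\<close> because \<open>\<lambda>\<close> is reserved.\<close>

definition weierstrass :: "(real \<Rightarrow> real) \<Rightarrow> real \<Rightarrow> nat \<Rightarrow> real \<Rightarrow> real" where
  "weierstrass \<phi> \<mu> b \<theta> = (\<Sum>j. \<mu> ^ j * \<phi> (real b ^ j * \<theta>))"

text \<open>The supremum in \<open>osc_sup\<close> is over a set of reals bounded by 1 when \<open>W\<close> is continuous,
  so the conditionally complete supremum on \<^typ>\<open>real\<close> is the true one.\<close>

definition osc_integral :: "(real \<Rightarrow> real) \<Rightarrow> int \<Rightarrow> real \<Rightarrow> complex" where
  "osc_integral W n t =
     integral {0..1} (\<lambda>\<theta>. exp (2 * pi * \<i> * of_int n * of_real \<theta>) * exp (\<i> * of_real t * of_real (W \<theta>)))"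

definition osc_sup :: "(real \<Rightarrow> real) \<Rightarrow> real \<Rightarrow> real" where
  "osc_sup W t = (SUP n. norm (osc_integral W n t))"

definition occupation_measure :: "(real \<Rightarrow> real) \<Rightarrow> real measure" where
  "occupation_measure W = distr (restrict_space lborel {0..<1}) borel W"

text \<open>Densities are determined only up to null sets, so \<open>is_local_time W\<close> holds of every
  real-valued version, and smoothness of the local time means that some version is smooth.
  Nonnegativity is required because \<^const>\<open>ennreal\<close> sends negative reals to 0.\<close>

definition is_local_time :: "(real \<Rightarrow> real) \<Rightarrow> (real \<Rightarrow> real) \<Rightarrow> bool" where
  "is_local_time W L \<longleftrightarrow> L \<in> borel_measurable borel \<and> (\<forall>x. 0 \<le> L x) \<and>
     occupation_measure W = density lborel (\<lambda>x. ennreal (L x))"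

definition C_k :: "nat \<Rightarrow> (real \<Rightarrow> real) \<Rightarrow> bool" where
  "C_k k f \<longleftrightarrow> (\<forall>j<k. \<forall>x. (deriv ^^ j) f differentiable (at x)) \<and>
     continuous_on UNIV ((deriv ^^ k) f)"

definition has_C_k_local_time :: "nat \<Rightarrow> (real \<Rightarrow> real) \<Rightarrow> bool" where
  "has_C_k_local_time k W \<longleftrightarrow> (\<exists>L. is_local_time W L \<and> C_k k L)"

end

theory Submission
  imports Defs "HOL-Probability.Levy" "HOL-Real_Asymp.Real_Asymp"
begin

text \<open>Write \<open>W\<close> for the Weierstrass function and \<open>I(t, g)\<close> for the integral of \<open>g(\<theta>) exp(i t W(\<theta>))\<close>
over the unit interval. Cutting the interval into \<open>b\<close> equal pieces and using
\<open>W(\<theta>) = \<phi>(\<theta>) + \<mu> W(b \<theta>)\<close> gives \<open>I(t, e(\<nu>\<cdot>) g) = I(\<mu> t, e((\<nu>/b)\<cdot>) T g)\<close>, where \<open>T\<close> averages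
\<open>g(\<theta>) exp(i t \<phi>(\<theta>))\<close> over the \<open>b\<close> inverse branches \<open>\<theta> = (x + j) / b\<close> with unimodular weights
(\<open>oscillatory_integral_transfer\<close>). The frequency \<open>\<nu>\<close> enters only through these weights and through a
unimodular factor, which is why every estimate below is uniform in the Fourier mode.

The heart of the matter is that, once \<open>\<bar>t\<bar> \<ge> b\<^sup>2\<close>, one step contracts the energy
\<open>\<parallel>g\<parallel>\<^sup>2 + (b / t\<^sup>2) \<parallel>g'\<parallel>\<^sup>2\<close> (norms in \<open>L\<^sup>2\<close>, and \<open>t\<close> replaced by \<open>\<mu> t\<close> on the image) by a factor
\<open>b powr (-\<gamma>/8)\<close> whose exponent depends on \<open>\<phi>\<close> alone (\<open>transfer_contraction\<close>). Expand \<open>\<parallel>T g\<parallel>\<^sup>2\<close> as a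
double sum over pairs of branches. If the slopes \<open>\<phi>'(j/b)\<close> and \<open>\<phi>'(k/b)\<close> differ by more than
\<open>\<delta> = b powr (-1/4)\<close>, the phase of the pair has derivative at least of order \<open>\<bar>t\<bar> \<delta> / b\<close> on the whole
branch and integration by parts wins; the derivative falling on \<open>g\<close> costs little because a branch
contracts by \<open>b\<close>. The remaining pairs are estimated trivially, but for each \<open>j\<close> there are only
\<open>O(b powr (1 - \<gamma>/4))\<close> of them: \<open>\<phi>'\<close> is analytic and not constant, so its sublevel sets are small
(\<open>analytic_sublevel_grid_count\<close>), and a Schur-type summation turns this count into a gain on
\<open>\<parallel>g\<parallel>\<^sup>2\<close>. Large \<open>b\<close> absorbs all constants, including \<open>1/\<mu>\<^sup>2\<close>; this is what the threshold on the
frequency ratio is for.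

Starting from \<open>g = 1\<close> one may iterate about \<open>ln \<bar>t\<bar> / \<bar>ln \<mu>\<bar>\<close> times before \<open>\<bar>t\<bar>\<close> drops below \<open>b\<^sup>2\<close>,
and the accumulated factor is a negative power of \<open>\<bar>t\<bar>\<close> of the asserted form (\<open>weierstrass_oscillatory_decay\<close>).

The characteristic function of the occupation measure is the oscillatory integral of mode 0. At the
threshold for \<open>C\<^sup>k\<close> the stated exponent is only \<open>k + 1\<close>, which is not quite integrable against
\<open>\<bar>t\<bar>\<^sup>k\<close>; the constant \<open>c\<close> is therefore chosen as half of the exponent that the contraction provides, so
that the true decay there is \<open>\<bar>t\<bar> powr (-2 (k + 1))\<close>, and Fourier inversion yields a \<open>C\<^sup>k\<close> density
(\<open>has_C_k_local_time_of_decay\<close>).\<close>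

section \<open>Nonconstant analytic functions have no flat points\<close>

lemma real_analytic_derivative:
  assumes "real_analytic f"
  shows "(f has_real_derivative deriv f x) (at x)" and "real_analytic (deriv f)"
proof -
  have shift: "deriv (\<lambda>h. f (x + h)) = (\<lambda>h. deriv f (x + h))" for x
    by (rule ext) (simp add: deriv_def DERIV_shift add.commute)
  show "real_analytic (deriv f)"
    unfolding real_analytic_def
  proof
    fix x
    obtain F where "(\<lambda>h. f (x + h)) has_fps_expansion F"
      using assms unfolding real_analytic_def by blast
    then have "(\<lambda>h. deriv f (x + h)) has_fps_expansion fps_deriv F"
      using has_fps_expansion_deriv shift by metis
    then show "\<exists>F. (\<lambda>h. deriv f (x + h)) has_fps_expansion F" by blast
  qed
  obtain F where F: "(\<lambda>h. f (x + h)) has_fps_expansion F"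
    using assms unfolding real_analytic_def by blast
  then have D: "(eval_fps F has_real_derivative eval_fps (fps_deriv F) 0) (at 0)"
    by (intro has_field_derivative_eval_fps) (auto simp: has_fps_expansion_def zero_ereal_def)
  have ev: "eventually (\<lambda>h. eval_fps F h = f (x + h)) (nhds 0)"
    using F by (auto simp: has_fps_expansion_def)
  have "((\<lambda>h. f (x + h)) has_real_derivative eval_fps (fps_deriv F) 0) (at 0)"
    by (rule iffD1[OF DERIV_cong_ev[OF refl ev refl] D])
  then have "(f has_real_derivative eval_fps (fps_deriv F) 0) (at x)"
    using DERIV_shift[of f _ 0 x] by (simp add: add.commute)
  then show "(f has_real_derivative deriv f x) (at x)"
    using DERIV_imp_deriv by metis
qed

lemma real_analytic_higher_deriv:
  assumes "real_analytic f"
  shows "real_analytic ((deriv ^^ m) f)"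
  by (induction m) (auto intro: assms real_analytic_derivative)

lemma real_analytic_higher_derivative:
  assumes "real_analytic f"
  shows "((deriv ^^ m) f has_real_derivative (deriv ^^ Suc m) f x) (at x)"
  using real_analytic_derivative(1)[OF real_analytic_higher_deriv[OF assms]] by simp

lemma real_analytic_isCont_higher_deriv:
  assumes "real_analytic f"
  shows "isCont ((deriv ^^ m) f) x"
  using real_analytic_higher_derivative[OF assms] DERIV_isCont by blast

text \<open>The derivatives at \<open>x\<close> are, up to factorials, the Taylor coefficients there, so the local power
series is a constant.\<close>

lemma real_analytic_flat_point_eventually_constant:
  assumes "real_analytic f" and "\<And>m. m \<ge> 1 \<Longrightarrow> (deriv ^^ m) f x = 0"
  shows "eventually (\<lambda>y. f y = f x) (nhds x)"
proof -
  obtain F where F: "(\<lambda>h. f (x + h)) has_fps_expansion F"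
    using assms unfolding real_analytic_def by blast
  have shift: "(deriv ^^ n) (\<lambda>h. f (x + h)) = (\<lambda>h. (deriv ^^ n) f (x + h))" for n
  proof (induction n)
    case (Suc n)
    then show ?case by (auto simp: deriv_def DERIV_shift add.commute)
  qed simp
  have expn: "(deriv ^^ n) (\<lambda>h. f (x + h)) has_fps_expansion ((fps_deriv ^^ n) F)" for n
    by (induction n) (auto intro: F has_fps_expansion_deriv)
  have value_at_0: "fps_nth A 0 = g 0" if "g has_fps_expansion A" for A :: "real fps" and g
  proof -
    have "eventually (\<lambda>z. eval_fps A z = g z) (nhds 0)"
      using that unfolding has_fps_expansion_def by blast
    from eventually_nhds_x_imp_x[OF this] show ?thesis by (simp add: eval_fps_at_0)
  qed
  have "fps_nth F n = 0" if "n \<ge> 1" for n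
  proof -
    have "fps_nth ((fps_deriv ^^ n) F) 0 = (deriv ^^ n) f (x + 0)"
      using value_at_0[OF expn[of n]] shift[of n] by metis
    then show ?thesis
      using assms(2)[OF that] by (simp add: fps_0th_higher_deriv)
  qed
  then have "fps_nth F n = fps_nth (fps_const (fps_nth F 0)) n" for n
    by (cases n) auto
  then have "F = fps_const (fps_nth F 0)" by (rule fps_ext)
  then obtain c where "F = fps_const c" by blast
  then have ev: "eventually (\<lambda>h. c = f (x + h)) (nhds 0)"
    using F by (auto simp: has_fps_expansion_def)
  have lim: "filterlim (\<lambda>y. y - x) (nhds 0) (nhds x)"
    using tendsto_diff[OF filterlim_ident tendsto_const, of x x] by simp
  have "eventually (\<lambda>y. c = f (x + (y - x))) (nhds x)"
    using eventually_compose_filterlim[OF ev lim] .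
  then have "eventually (\<lambda>y. c = f y) (nhds x)" by simp
  moreover from this have "c = f x" by (rule eventually_nhds_x_imp_x)
  ultimately show ?thesis by (simp add: eq_commute)
qed

text \<open>The identity theorem on the line: the set of points at which all derivatives of positive order
vanish is closed by continuity and open by local constancy, so it is empty or everything, and in the
second case \<open>f\<close> is constant.\<close>

lemma real_analytic_no_flat_point:
  assumes f: "real_analytic f" and nonconst: "f y \<noteq> f z"
  shows "\<exists>m\<ge>1. (deriv ^^ m) f x \<noteq> 0"
proof (rule ccontr)
  assume H: "\<not> ?thesis"
  define Z where "Z = {u. \<forall>m\<ge>1. (deriv ^^ m) f u = 0}"
  have "Z = (\<Inter>m\<in>{1..}. {u. (deriv ^^ m) f u = 0})" by (auto simp: Z_def)
  moreover have "closed {u. (deriv ^^ m) f u = 0}" for m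
    using real_analytic_isCont_higher_deriv[OF f]
    by (intro closed_Collect_eq) (auto intro: continuous_at_imp_continuous_on)
  ultimately have "closed Z" by auto
  moreover have "open Z"
  proof (subst open_subopen, intro ballI)
    fix u assume "u \<in> Z"
    then have "eventually (\<lambda>y. f y = f u) (nhds u)"
      by (intro real_analytic_flat_point_eventually_constant f) (auto simp: Z_def)
    then obtain S where S: "open S" "u \<in> S" "\<And>y. y \<in> S \<Longrightarrow> f y = f u"
      unfolding eventually_nhds by blast
    have "(deriv ^^ m) f y = 0" if "m \<ge> 1" "y \<in> S" for m y
    proof -
      have "(deriv ^^ m) f y = (deriv ^^ m) (\<lambda>_. f u) y"
        by (rule higher_deriv_cong_ev[OF eventually_mono[OF eventually_nhds_in_open[OF S(1) that(2)]]])
          (use S(3) in auto)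
      moreover have "(deriv ^^ m) (\<lambda>_. f u) = (\<lambda>_. 0)" using that(1)
        by (induction m rule: dec_induct) auto
      ultimately show ?thesis by simp
    qed
    then show "\<exists>T. open T \<and> u \<in> T \<and> T \<subseteq> Z" using S by (auto simp: Z_def)
  qed
  moreover have "x \<in> Z" using H by (auto simp: Z_def)
  ultimately have "Z = UNIV" using clopen[of Z] by blast
  then have "deriv f u = 0" for u
  proof -
    have "u \<in> Z" using \<open>Z = UNIV\<close> by simp
    then have "(deriv ^^ 1) f u = 0" unfolding Z_def by blast
    then show ?thesis by simp
  qed
  then have "(f has_real_derivative 0) (at u)" for u
    using real_analytic_derivative(1)[OF f, of u] by simp
  then have "f y = f z" using DERIV_isconst_all by blast
  with nonconst show False by simp
qed

text \<open>A function with constant derivative is affine, and periodicity forces its slope to be 0.\<close>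

lemma periodic_nonconstant_derivative_nonconstant:
  assumes f: "real_analytic f" and per: "\<And>x. f (x + 1) = f x" and "\<not> f constant_on UNIV"
  shows "\<exists>y z. deriv f y \<noteq> deriv f z"
proof (rule ccontr)
  assume "\<not> ?thesis"
  then have eq: "deriv f x = deriv f 0" for x by blast
  have D: "(f has_real_derivative deriv f 0) (at x)" for x
    using real_analytic_derivative(1)[OF f, of x] by (subst (asm) eq)
  have "((\<lambda>x. f x - deriv f 0 * x) has_real_derivative 0) (at x)" for x
    by (auto intro!: derivative_eq_intros D)
  then have lin: "f x - deriv f 0 * x = f y - deriv f 0 * y" for x y
    using DERIV_isconst_all[of "\<lambda>x. f x - deriv f 0 * x" x y] by blast
  have "deriv f 0 = 0" using lin[of 0 1] per[of 0] by simp
  then have "f x = f 0" for x using lin[of x 0] by simp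
  with assms(3) show False by (auto simp: constant_on_def)
qed

section \<open>Sublevel sets of analytic functions on a grid\<close>

text \<open>Smallness at many separated points propagates to the derivatives. Group \<open>2 ^ m\<close> points into
consecutive pairs; the mean value theorem on each pair gives \<open>2 ^ (m - 1)\<close> points where the derivative
is at most \<open>2 \<delta> / s\<close>. Two such points are still \<open>s\<close> apart, since the gap between neighbouring pairs
lies between them, so the argument can be repeated.\<close>

lemma separated_points_small_derivative:
  fixes F :: "nat \<Rightarrow> real \<Rightarrow> real" and x :: "nat \<Rightarrow> real" and p q s \<delta> :: real
  assumes "\<And>i x. i < m \<Longrightarrow> x \<in> {p..q} \<Longrightarrow> (F i has_real_derivative F (Suc i) x) (at x)"
    and "s > 0"
    and "\<And>i. i < 2 ^ m \<Longrightarrow> x i \<in> {p..q}" and "\<And>i. i < 2 ^ m \<Longrightarrow> \<bar>F 0 (x i)\<bar> \<le> \<delta>"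
    and "\<And>i. Suc i < 2 ^ m \<Longrightarrow> x i + s \<le> x (Suc i)"
  shows "\<exists>z\<in>{p..q}. \<bar>F m z\<bar> \<le> \<delta> * (2 / s) ^ m"
  using assms
proof (induction m arbitrary: F x \<delta>)
  case 0
  then show ?case by (intro bexI[of _ "x 0"]) auto
next
  case (Suc m)
  have ex: "\<exists>z. x (2*i) < z \<and> z < x (2*i+1) \<and> \<bar>F 1 z\<bar> \<le> 2 * \<delta> / s" if "i < 2 ^ m" for i
  proof -
    have lt: "2 * i < 2 ^ Suc m" "2 * i + 1 < 2 ^ Suc m" using that by auto
    have gap: "x (2*i) + s \<le> x (2*i+1)" using Suc.prems(5)[of "2*i"] lt by simp
    have mem: "x (2*i) \<in> {p..q}" "x (2*i+1) \<in> {p..q}" using Suc.prems(3) lt by blast+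
    have "\<exists>z. x (2*i) < z \<and> z < x (2*i+1) \<and>
        F 0 (x (2*i+1)) - F 0 (x (2*i)) = (x (2*i+1) - x (2*i)) * F 1 z"
      by (rule MVT2) (use gap \<open>s > 0\<close> Suc.prems(1)[of 0] mem in auto)
    then obtain z where z: "x (2*i) < z" "z < x (2*i+1)"
      "F 0 (x (2*i+1)) - F 0 (x (2*i)) = (x (2*i+1) - x (2*i)) * F 1 z" by blast
    have "s * \<bar>F 1 z\<bar> \<le> (x (2*i+1) - x (2*i)) * \<bar>F 1 z\<bar>"
      using gap by (intro mult_right_mono) auto
    also have "\<dots> = \<bar>(x (2*i+1) - x (2*i)) * F 1 z\<bar>"
      using gap \<open>s > 0\<close> by (simp add: abs_mult)
    also have "\<dots> = \<bar>F 0 (x (2*i+1)) - F 0 (x (2*i))\<bar>" using z(3) by simp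
    also have "\<dots> \<le> 2 * \<delta>"
      using Suc.prems(4)[OF lt(1)] Suc.prems(4)[OF lt(2)] by linarith
    finally show ?thesis using z \<open>s > 0\<close> by (auto simp: field_simps)
  qed
  then obtain z where z: "\<And>i. i < 2 ^ m \<Longrightarrow> x (2*i) < z i \<and> z i < x (2*i+1) \<and> \<bar>F 1 (z i)\<bar> \<le> 2 * \<delta> / s"
    by metis
  have "\<exists>w\<in>{p..q}. \<bar>(\<lambda>i. F (Suc i)) m w\<bar> \<le> (2 * \<delta> / s) * (2 / s) ^ m"
  proof (rule Suc.IH[where x = z])
    show "s > 0" by fact
    fix i
    show "z i \<in> {p..q}" if "i < 2 ^ m"
    proof -
      have "x (2*i) \<in> {p..q}" "x (2*i+1) \<in> {p..q}"
        by (rule Suc.prems(3); use that in simp)+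
      then show ?thesis using z[OF that] by auto
    qed
    show "\<bar>F (Suc 0) (z i)\<bar> \<le> 2 * \<delta> / s" if "i < 2 ^ m" using z[OF that] by simp
    show "z i + s \<le> z (Suc i)" if "Suc i < 2 ^ m"
      using z[of i] z[of "Suc i"] that Suc.prems(5)[of "2*i+1"] by simp
    show "(F (Suc i) has_real_derivative F (Suc (Suc i)) y) (at y)" if "i < m" "y \<in> {p..q}" for y
      using Suc.prems(1) that by simp
  qed
  then show ?case by (auto simp: field_simps)
qed

lemma strict_sorted_nat_nth_gap:
  fixes l :: "nat list"
  assumes "sorted_wrt (<) l" and "i + r < length l"
  shows "l ! i + r \<le> l ! (i + r)"
  using assms(2)
proof (induction r)
  case (Suc r)
  then have "l ! i + r \<le> l ! (i + r)" by simp
  moreover have "l ! (i + r) < l ! (i + Suc r)"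
    using assms(1) Suc.prems by (intro sorted_wrt_nth_less) auto
  ultimately show ?case by simp
qed simp

text \<open>Contrapositive use of the previous lemma: a sublevel set with \<open>r * 2 ^ m\<close> grid points contains
\<open>2 ^ m\<close> points of mutual distance at least \<open>r / b \<ge> s\<close>, obtained by taking every \<open>r\<close>-th one.\<close>

lemma card_separated_grid_points:
  fixes F :: "nat \<Rightarrow> real \<Rightarrow> real" and b :: nat and p q s \<delta> :: real
  assumes der: "\<And>i x. i < m \<Longrightarrow> x \<in> {p..q} \<Longrightarrow> (F i has_real_derivative F (Suc i) x) (at x)"
    and "b \<ge> 1" "s > 0" "real r \<ge> s * b"
    and big: "\<And>x. x \<in> {p..q} \<Longrightarrow> \<delta> * (2 / s) ^ m < \<bar>F m x\<bar>"
    and S: "finite S" "\<And>k. k \<in> S \<Longrightarrow> real k / b \<in> {p..q} \<and> \<bar>F 0 (real k / b)\<bar> \<le> \<delta>"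
  shows "card S < r * 2 ^ m"
proof (rule ccontr)
  assume "\<not> ?thesis"
  then have card: "r * 2 ^ m \<le> card S" by simp
  have "r \<ge> 1" using assms(2-4) by (metis less_one linorder_not_less mult_pos_pos of_nat_0 of_nat_0_less_iff order_less_le_trans)
  define l where "l = sorted_list_of_set S"
  have l: "sorted_wrt (<) l" "set l = S" "length l = card S"
    using S(1) by (auto simp: l_def)
  have len: "r * i < length l" if "i < 2 ^ m" for i
    using that card l(3) \<open>r \<ge> 1\<close>
    by (metis less_le_trans mult_less_cancel1 not_one_le_zero gr0I)
  have "\<exists>z\<in>{p..q}. \<bar>F m z\<bar> \<le> \<delta> * (2 / s) ^ m"
  proof (rule separated_points_small_derivative[where x = "\<lambda>i. real (l ! (r * i)) / b" and F = F])
    show "s > 0" by fact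
    show "(F i has_real_derivative F (Suc i) x) (at x)" if "i < m" "x \<in> {p..q}" for i and x :: real
      by (rule der) fact+
    fix i
    show "real (l ! (r * i)) / b \<in> {p..q}" "\<bar>F 0 (real (l ! (r * i)) / b)\<bar> \<le> \<delta>" if "i < 2 ^ m"
      using len[OF that] l(2) S(2) nth_mem by metis+
    show "real (l ! (r * i)) / b + s \<le> real (l ! (r * Suc i)) / b" if i: "Suc i < 2 ^ m"
    proof -
      have "l ! (r * i) + r \<le> l ! (r * i + r)"
        using len[OF i] by (intro strict_sorted_nat_nth_gap l) (simp add: add.commute)
      then have "real (l ! (r * i)) + r \<le> real (l ! (r * Suc i))"
        by (simp add: add.commute flip: of_nat_add)
      then have "real (l ! (r * i)) + s * b \<le> real (l ! (r * Suc i))" using assms(4) by linarith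
      then have "(real (l ! (r * i)) + s * b) / b \<le> real (l ! (r * Suc i)) / b"
        by (rule divide_right_mono) simp
      then show ?thesis using \<open>b \<ge> 1\<close> by (simp add: add_divide_distrib)
    qed
  qed
  then show False using big by force
qed

lemma finite_nat_between: "finite {k::nat. a * real b \<le> real k \<and> real k \<le> c * real b \<and> P k}"
proof (rule finite_subset)
  show "{k::nat. a * real b \<le> real k \<and> real k \<le> c * real b \<and> P k} \<subseteq> {..nat \<lceil>c * real b\<rceil>}"
    by (auto simp: le_nat_iff) linarith
qed simp

text \<open>A level \<open>y\<close> may be subtracted freely because it disappears from all derivatives of order
\<open>m \<ge> 1\<close>; this makes the bound uniform in \<open>y\<close>.\<close>

lemma sublevel_grid_count_of_large_derivative:
  fixes F :: "nat \<Rightarrow> real \<Rightarrow> real" and p q \<eta> :: real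
  assumes der: "\<And>i x. (F i has_real_derivative F (Suc i) x) (at x)"
    and "m \<ge> 1" "\<eta> > 0"
    and big: "\<And>x. x \<in> {p..q} \<Longrightarrow> \<eta> \<le> \<bar>F m x\<bar>"
  shows "\<exists>K>0. \<forall>(b::nat)\<ge>1. \<forall>y \<delta>. 0 < \<delta> \<and> \<delta> \<le> 1 \<longrightarrow>
    real (card {k::nat. p * b \<le> k \<and> k \<le> q * b \<and> \<bar>F 0 (k / b) - y\<bar> \<le> \<delta>})
      \<le> K * (b * \<delta> powr (1 / m) + 1)"
proof -
  define s0 where "s0 = 2 * (2 / \<eta>) powr (1 / m)"
  have "s0 > 0" using \<open>\<eta> > 0\<close> by (simp add: s0_def)
  define K where "K = 2 ^ m * max 2 s0"
  have "real (card {k::nat. p * b \<le> k \<and> k \<le> q * b \<and> \<bar>F 0 (k / b) - y\<bar> \<le> \<delta>})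
      \<le> K * (b * \<delta> powr (1 / m) + 1)" (is "real (card ?S) \<le> _")
    if "b \<ge> 1" "0 < \<delta>" "\<delta> \<le> 1" for b :: nat and y \<delta>
  proof -
    \<comment> \<open>The spacing at which the guaranteed smallness \<open>\<delta> * (2 / s) ^ m\<close> of the \<open>m\<close>-th derivative
      is exactly \<open>\<eta> / 2\<close>.\<close>
    define s where "s = s0 * \<delta> powr (1 / m)"
    have "s > 0" using \<open>s0 > 0\<close> that by (simp add: s_def)
    define r where "r = nat \<lceil>s * b\<rceil>"
    have r: "real r \<ge> s * b" "real r \<le> s * b + 1"
      using \<open>s > 0\<close> by (auto simp: r_def of_nat_ceiling)
    define G where "G = (\<lambda>i x. if i = 0 then F 0 x - y else F i x)"
    have "s = 2 * (2 * \<delta> / \<eta>) powr (1 / m)"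
      using that \<open>\<eta> > 0\<close> by (simp add: s_def s0_def powr_mult powr_divide)
    then have "(2 / s) ^ m = 1 / ((2 * \<delta> / \<eta>) powr (1 / m)) ^ m"
      by (simp add: power_divide)
    also have "((2 * \<delta> / \<eta>) powr (1 / m)) ^ m = 2 * \<delta> / \<eta>"
      using that \<open>\<eta> > 0\<close> \<open>m \<ge> 1\<close> by (simp add: powr_realpow[symmetric] powr_powr)
    finally have "\<delta> * (2 / s) ^ m = \<eta> / 2" using that \<open>\<eta> > 0\<close> by (simp add: field_simps)
    then have lt: "\<delta> * (2 / s) ^ m < \<eta>" using \<open>\<eta> > 0\<close> by simp
    have "card ?S < r * 2 ^ m"
    proof (rule card_separated_grid_points[where F = G and \<delta> = \<delta> and p = p and q = q and b = b and s = s])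
      show "(G i has_real_derivative G (Suc i) x) (at x)" for i x
        using der[of i x] unfolding G_def by (cases "i = 0") (auto intro!: derivative_eq_intros)
      show "b \<ge> 1" "s > 0" "real r \<ge> s * b" by fact+
      show "\<delta> * (2 / s) ^ m < \<bar>G m x\<bar>" if "x \<in> {p..q}" for x
        using big[OF that] lt \<open>m \<ge> 1\<close> by (simp add: G_def)
      show "finite ?S" by (rule finite_nat_between)
      show "real k / b \<in> {p..q} \<and> \<bar>G 0 (real k / b)\<bar> \<le> \<delta>" if "k \<in> ?S" for k
      proof -
        have "p * b \<le> k" "k \<le> q * b" "\<bar>F 0 (k / b) - y\<bar> \<le> \<delta>" using that by auto
        moreover have "(0::real) < b" using \<open>b \<ge> 1\<close> by simp
        ultimately show ?thesis by (simp add: G_def le_divide_eq divide_le_eq)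
      qed
    qed
    then have "real (card ?S) \<le> real (r * 2 ^ m)" by (simp only: of_nat_le_iff less_imp_le)
    then have "real (card ?S) \<le> real r * 2 ^ m" by simp
    also have "\<dots> \<le> (s0 * (\<delta> powr (1 / m) * b) + 1) * 2 ^ m"
      using r(2) by (intro mult_right_mono) (auto simp: s_def mult.assoc)
    also have "\<dots> \<le> (max 2 s0 * (\<delta> powr (1 / m) * b) + max 2 s0) * 2 ^ m"
      by (intro mult_right_mono add_mono) auto
    also have "\<dots> = K * (b * \<delta> powr (1 / m) + 1)" by (simp add: K_def algebra_simps)
    finally show ?thesis .
  qed
  moreover have "K > 0" by (simp add: K_def)
  ultimately show ?thesis by blast
qed

text \<open>Near each point some derivative of positive order stays away from 0, which gives the estimate on
a short interval with an exponent depending on that order. Compactness, in the form of the Bolzano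
induction principle for intervals, leaves finitely many exponents, of which the smallest is kept.\<close>

lemma analytic_sublevel_grid_count:
  assumes G: "real_analytic G" and nonconst: "G y0 \<noteq> G z0"
  shows "\<exists>K>0. \<exists>\<gamma>>0. \<gamma> \<le> 1 \<and> (\<forall>(b::nat)\<ge>1. \<forall>y \<delta>. 0 < \<delta> \<and> \<delta> \<le> 1 \<longrightarrow>
    real (card {k::nat. k \<le> b \<and> \<bar>G (k / b) - y\<bar> \<le> \<delta>})
      \<le> K * (b * \<delta> powr \<gamma> + 1))" 
proof -
  let ?P = "\<lambda>(p::real) (q::real). \<exists>K>0. \<exists>\<gamma>>0. \<gamma> \<le> 1 \<and> (\<forall>(b::nat)\<ge>1. \<forall>y \<delta>. 0 < \<delta> \<and> \<delta> \<le> 1 \<longrightarrow>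
    real (card {k::nat. p * b \<le> k \<and> k \<le> q * b \<and> \<bar>G (k / b) - y\<bar> \<le> \<delta>})
      \<le> K * (b * \<delta> powr \<gamma> + 1))"
  let ?S = "\<lambda>p q (b::nat) y \<delta>. {k::nat. p * b \<le> k \<and> k \<le> q * b \<and> \<bar>G (k / b) - y\<bar> \<le> \<delta>}"
  have "(0::real) \<le> 1" by simp
  then have "?P 0 1"
  proof (induction rule: Bolzano[where P = ?P])
    case (trans p q r)
    from trans(1) obtain K1 g1 where 1: "K1 > 0" "g1 > 0" "g1 \<le> 1"
      "\<And>b y \<delta>. b \<ge> 1 \<Longrightarrow> 0 < \<delta> \<Longrightarrow> \<delta> \<le> 1 \<Longrightarrow> real (card (?S p q b y \<delta>)) \<le> K1 * (b * \<delta> powr g1 + 1)"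
      by blast
    from trans(2) obtain K2 g2 where 2: "K2 > 0" "g2 > 0" "g2 \<le> 1"
      "\<And>b y \<delta>. b \<ge> 1 \<Longrightarrow> 0 < \<delta> \<Longrightarrow> \<delta> \<le> 1 \<Longrightarrow> real (card (?S q r b y \<delta>)) \<le> K2 * (b * \<delta> powr g2 + 1)"
      by blast
    have "real (card (?S p r b y \<delta>)) \<le> (K1 + K2) * (b * \<delta> powr (min g1 g2) + 1)"
      if "b \<ge> 1" "0 < \<delta>" "\<delta> \<le> 1" for b y \<delta>
    proof -
      have "card (?S p r b y \<delta>) \<le> card (?S p q b y \<delta> \<union> ?S q r b y \<delta>)"
        by (rule card_mono) (auto intro: finite_nat_between)
      also have "\<dots> \<le> card (?S p q b y \<delta>) + card (?S q r b y \<delta>)" by (rule card_Un_le)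
      finally have "real (card (?S p r b y \<delta>)) \<le> card (?S p q b y \<delta>) + card (?S q r b y \<delta>)"
        by (simp flip: of_nat_add)
      also have "\<dots> \<le> K1 * (b * \<delta> powr g1 + 1) + K2 * (b * \<delta> powr g2 + 1)"
        using 1(4)[OF that, of y] 2(4)[OF that, of y] by simp
      also have "\<dots> \<le> K1 * (b * \<delta> powr (min g1 g2) + 1) + K2 * (b * \<delta> powr (min g1 g2) + 1)"
        using 1 2 that
        by (intro add_mono mult_left_mono order_refl powr_mono') auto
      finally show ?thesis by (simp add: algebra_simps)
    qed
    moreover have "K1 + K2 > 0" "min g1 g2 > 0" "min g1 g2 \<le> 1" using 1 2 by auto
    ultimately show ?case by blast
  next
    case (local x)
    obtain m where m: "m \<ge> 1" "(deriv ^^ m) G x \<noteq> 0"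
      using real_analytic_no_flat_point[OF G nonconst] by blast
    define \<eta> where "\<eta> = \<bar>(deriv ^^ m) G x\<bar> / 2"
    have "\<eta> > 0" using m by (simp add: \<eta>_def)
    have "isCont (\<lambda>u. \<bar>(deriv ^^ m) G u\<bar>) x"
      using real_analytic_isCont_higher_deriv[OF G] by (intro continuous_intros) auto
    then have "\<exists>d>0. \<forall>u. dist u x < d \<longrightarrow> dist \<bar>(deriv ^^ m) G u\<bar> \<bar>(deriv ^^ m) G x\<bar> < \<eta>"
      using \<open>\<eta> > 0\<close> unfolding continuous_at_eps_delta by blast
    then obtain d where d: "d > 0" "\<And>u. \<bar>u - x\<bar> < d \<Longrightarrow> \<eta> \<le> \<bar>(deriv ^^ m) G u\<bar>"
      unfolding dist_real_def \<eta>_def by (smt (verit) field_sum_of_halves)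
    have "?P p q" if "p \<le> x" "x \<le> q" "q - p < d" for p q
    proof -
      have "\<exists>K>0. \<forall>(b::nat)\<ge>1. \<forall>y \<delta>. 0 < \<delta> \<and> \<delta> \<le> 1 \<longrightarrow>
        real (card {k::nat. p * b \<le> k \<and> k \<le> q * b \<and> \<bar>(deriv ^^ 0) G (k / b) - y\<bar> \<le> \<delta>})
          \<le> K * (b * \<delta> powr (1 / m) + 1)"
        by (rule sublevel_grid_count_of_large_derivative[where F = "\<lambda>i. (deriv ^^ i) G"])
          (rule real_analytic_higher_derivative[OF G], fact, fact, rule d(2), use that in auto)
      then obtain K where K: "K > 0" "\<And>b y \<delta>. b \<ge> 1 \<Longrightarrow> 0 < \<delta> \<Longrightarrow> \<delta> \<le> 1 \<Longrightarrow>
          real (card (?S p q b y \<delta>)) \<le> K * (b * \<delta> powr (1 / m) + 1)"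
        unfolding funpow_0 by blast
      show ?thesis
        by (rule exI[of _ K], intro conjI K(1), rule exI[of _ "1 / real m"]) (use m K(2) in auto)
    qed
    then show ?case using d(1) by blast
  qed
  then show ?thesis by simp
qed

section \<open>Non-stationary phase\<close>

lemma has_vector_derivative_cis:
  assumes "(h has_real_derivative d) (at x within S)"
  shows "((\<lambda>x. cis (h x)) has_vector_derivative of_real d * (\<i> * cis (h x))) (at x within S)"
proof -
  have "((\<lambda>x. \<i> * of_real (h x)) has_vector_derivative \<i> * of_real d) (at x within S)"
    using assms by (auto intro!: derivative_eq_intros has_vector_derivative_of_real
        simp: has_real_derivative_iff_has_vector_derivative)
  from field_vector_diff_chain_within[OF this, of exp "exp (\<i> * of_real (h x))"]
  show ?thesis
    by (simp add: o_def cis_conv_exp DERIV_exp has_field_derivative_at_within mult_ac)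
qed

text \<open>Sobolev bound in one dimension. It replaces the boundary terms of an integration by parts by
integrals, which can be summed over the branches.\<close>

lemma norm_le_integral_norm_plus_derivative:
  fixes p p' :: "real \<Rightarrow> complex"
  assumes p: "\<And>x. (p has_vector_derivative p' x) (at x)" and p': "continuous_on UNIV p'"
    and x: "x \<in> {0..1}"
  shows "norm (p x) \<le> integral {0..1} (\<lambda>u. norm (p u)) + integral {0..1} (\<lambda>u. norm (p' u))"
proof -
  have contp: "continuous_on S p" for S
    using p by (intro continuous_at_imp_continuous_on) (auto intro: has_vector_derivative_continuous)
  have intp: "(\<lambda>u. norm (p' u)) integrable_on {a..b}" for a b
    by (intro integrable_continuous_interval continuous_intros continuous_on_subset[OF p']) auto
  have diff: "norm (p v - p u) \<le> integral {0..1} (\<lambda>u. norm (p' u))"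
    if "0 \<le> u" "u \<le> v" "v \<le> 1" for u v
  proof -
    have "(p' has_integral (p v - p u)) {u..v}"
      using that p by (intro fundamental_theorem_of_calculus) (auto intro: has_vector_derivative_at_within)
    then have "norm (p v - p u) = norm (integral {u..v} p')" by (simp add: integral_unique)
    also have "\<dots> \<le> integral {u..v} (\<lambda>u. norm (p' u))"
      by (intro Henstock_Kurzweil_Integration.integral_norm_bound_integral intp
          integrable_continuous_interval continuous_on_subset[OF p']) auto
    also have "\<dots> \<le> integral {0..1} (\<lambda>u. norm (p' u))"
      using that by (intro integral_subset_le intp) auto
    finally show ?thesis .
  qed
  have "norm (p x) \<le> norm (p u) + integral {0..1} (\<lambda>u. norm (p' u))" if "u \<in> {0..1}" for u
  proof (cases "u \<le> x")
    case True
    then show ?thesis using diff[of u x] that x norm_triangle_ineq2[of "p x" "p u"] by auto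
  next
    case False
    then show ?thesis using diff[of x u] that x norm_triangle_ineq3[of "p u" "p x"] by auto
  qed
  then have "integral {0..1} (\<lambda>u::real. norm (p x)) \<le>
      integral {0..1} (\<lambda>u. norm (p u) + integral {0..1} (\<lambda>u. norm (p' u)))"
    by (intro integral_le integrable_continuous_interval continuous_intros contp) auto
  also have "\<dots> = integral {0..1} (\<lambda>u. norm (p u)) + integral {0..1} (\<lambda>u. norm (p' u))"
    by (subst Henstock_Kurzweil_Integration.integral_add)
      (auto intro!: integrable_continuous_interval continuous_intros contp)
  finally show ?thesis by simp
qed

text \<open>Integration by parts against \<open>1 / (\<tau> \<psi>')\<close>. The contributions are \<open>1 / \<kappa>\<close> times \<open>\<integral>\<bar>p'\<bar>\<close>,
\<open>M / \<kappa>\<^sup>2\<close> times \<open>\<integral>\<bar>p\<bar>\<close> from differentiating \<open>1 / \<psi>'\<close>, and two boundary terms, each at most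
\<open>(\<integral>\<bar>p\<bar> + \<integral>\<bar>p'\<bar>) / \<kappa>\<close>.\<close>

lemma nonstationary_phase:
  fixes p p' :: "real \<Rightarrow> complex" and \<psi> \<psi>' \<psi>'' :: "real \<Rightarrow> real" and \<tau> \<kappa> M :: real
  assumes p: "\<And>x. (p has_vector_derivative p' x) (at x)" and p': "continuous_on UNIV p'"
    and \<psi>: "\<And>x. (\<psi> has_real_derivative \<psi>' x) (at x)" "\<And>x. (\<psi>' has_real_derivative \<psi>'' x) (at x)"
    and \<psi>'': "continuous_on UNIV \<psi>''"
    and \<kappa>: "\<kappa> > 0" "\<And>x. x \<in> {0..1} \<Longrightarrow> \<kappa> \<le> \<bar>\<psi>' x\<bar>"
    and M: "\<And>x. x \<in> {0..1} \<Longrightarrow> \<bar>\<psi>'' x\<bar> \<le> M" and "\<tau> \<noteq> 0"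
  shows "norm (integral {0..1} (\<lambda>x. p x * cis (\<tau> * \<psi> x))) \<le>
    ((2 / \<kappa> + M / \<kappa>\<^sup>2) * integral {0..1} (\<lambda>x. norm (p x))
      + 3 / \<kappa> * integral {0..1} (\<lambda>x. norm (p' x))) / \<bar>\<tau>\<bar>"
proof -
  define u where "u = (\<lambda>x. cis (\<tau> * \<psi> x))"
  define r where "r = (\<lambda>x. 1 / (\<tau> * \<psi>' x))"
  define r' where "r' = (\<lambda>x. - \<psi>'' x / (\<tau> * (\<psi>' x)\<^sup>2))"
  have nz: "\<psi>' x \<noteq> 0" if "x \<in> {0..1}" for x using \<kappa>(1) \<kappa>(2)[OF that] by auto
  have cp: "continuous_on S p" for S
    using p by (intro continuous_at_imp_continuous_on) (auto intro: has_vector_derivative_continuous)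
  have c\<psi>: "continuous_on S \<psi>" "continuous_on S \<psi>'" for S
    using \<psi> by (auto intro!: continuous_at_imp_continuous_on DERIV_isCont)
  have cu: "continuous_on S u" for S unfolding u_def by (intro continuous_intros c\<psi>)
  have cp'': "continuous_on {0..1} p'" "continuous_on {0..1} \<psi>''"
    using p' \<psi>'' by (auto intro: continuous_on_subset)
  have cr: "continuous_on {0..1} r" "continuous_on {0..1} r'"
    unfolding r_def r'_def using nz \<open>\<tau> \<noteq> 0\<close>
    by (auto intro!: continuous_intros c\<psi> cp'')
  have du: "(u has_vector_derivative of_real (\<tau> * \<psi>' x) * (\<i> * u x)) (at x within {0..1})" for x
    unfolding u_def
    by (intro has_vector_derivative_cis DERIV_cmult has_field_derivative_at_within[OF \<psi>(1)])
  have dr: "(r has_real_derivative r' x) (at x within {0..1})" if "x \<in> {0..1}" for x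
    unfolding r_def r'_def using nz[OF that] \<open>\<tau> \<noteq> 0\<close>
    by (auto intro!: derivative_eq_intros has_field_derivative_at_within[OF \<psi>(2)] simp: power2_eq_square)
  define Q where "Q = (\<lambda>x. r x *\<^sub>R (p x * u x))"
  define E where "E = (\<lambda>x. r' x *\<^sub>R (p x * u x) + r x *\<^sub>R (p' x * u x))"
  have dQ: "(Q has_vector_derivative E x + \<i> * (p x * u x)) (at x within {0..1})"
    if "x \<in> {0..1}" for x
  proof -
    have 1: "of_real (r x * (\<tau> * \<psi>' x)) = (1::complex)"
      using nz[OF that] \<open>\<tau> \<noteq> 0\<close> by (simp add: r_def)
    have "(Q has_vector_derivative r x *\<^sub>R (p x * (of_real (\<tau> * \<psi>' x) * (\<i> * u x)) + p' x * u x)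
        + r' x *\<^sub>R (p x * u x)) (at x within {0..1})"
      unfolding Q_def
      by (intro has_vector_derivative_scaleR dr that has_vector_derivative_mult du
          has_vector_derivative_at_within[OF p])
    also have "r x *\<^sub>R (p x * (of_real (\<tau> * \<psi>' x) * (\<i> * u x)) + p' x * u x) + r' x *\<^sub>R (p x * u x)
        = E x + of_real (r x * (\<tau> * \<psi>' x)) * (\<i> * (p x * u x))"
      by (simp add: E_def scaleR_conv_of_real algebra_simps)
    finally show ?thesis by (simp only: 1 mult_1)
  qed
  have cE: "continuous_on {0..1} E"
    unfolding E_def by (intro continuous_intros cr cp cu cp'')
  have int: "((\<lambda>x. E x + \<i> * (p x * u x)) has_integral Q 1 - Q 0) {0..1}"
    by (rule fundamental_theorem_of_calculus) (use dQ in auto)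
  have "integral {0..1} (\<lambda>x. E x + \<i> * (p x * u x))
      = integral {0..1} E + \<i> * integral {0..1} (\<lambda>x. p x * u x)"
    by (subst Henstock_Kurzweil_Integration.integral_add)
      (auto intro!: integrable_continuous_interval continuous_intros cE cp cu)
  then have "\<i> * integral {0..1} (\<lambda>x. p x * u x) = Q 1 - Q 0 - integral {0..1} E"
    using integral_unique[OF int] by (simp add: algebra_simps)
  then have "norm (integral {0..1} (\<lambda>x. p x * u x)) = norm (Q 1 - Q 0 - integral {0..1} E)"
    by (metis norm_mult norm_ii mult_1)
  also have "\<dots> \<le> norm (Q 1) + norm (Q 0) + norm (integral {0..1} E)"
    using norm_triangle_ineq4[of "Q 1 - Q 0" "integral {0..1} E"] norm_triangle_ineq4[of "Q 1" "Q 0"]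
    by linarith
  finally have start: "norm (integral {0..1} (\<lambda>x. p x * u x)) \<le>
    norm (Q 1) + norm (Q 0) + norm (integral {0..1} E)" .
  define A where "A = integral {0..1} (\<lambda>x. norm (p x))"
  define B where "B = integral {0..1} (\<lambda>x. norm (p' x))"
  have rb: "\<bar>r x\<bar> \<le> 1 / (\<kappa> * \<bar>\<tau>\<bar>)" if "x \<in> {0..1}" for x
    using \<kappa>(1) \<kappa>(2)[OF that] \<open>\<tau> \<noteq> 0\<close> by (auto simp: r_def abs_mult field_simps)
  have r'b: "\<bar>r' x\<bar> \<le> M / (\<kappa>\<^sup>2 * \<bar>\<tau>\<bar>)" if "x \<in> {0..1}" for x
  proof -
    have "\<kappa>\<^sup>2 \<le> \<bar>\<psi>' x\<bar>\<^sup>2" using \<kappa>(1) \<kappa>(2)[OF that] by (intro power_mono) auto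
    then have "\<bar>\<psi>'' x\<bar> / (\<bar>\<tau>\<bar> * (\<psi>' x)\<^sup>2) \<le> M / (\<bar>\<tau>\<bar> * \<kappa>\<^sup>2)"
      using M[OF that] \<kappa>(1) \<open>\<tau> \<noteq> 0\<close> by (intro frac_le mult_left_mono) (auto intro!: mult_pos_pos)
    then show ?thesis by (simp add: r'_def abs_mult mult.commute)
  qed
  have Qb: "norm (Q x) \<le> (A + B) / (\<kappa> * \<bar>\<tau>\<bar>)" if "x \<in> {0..1}" for x
  proof -
    have "norm (Q x) = \<bar>r x\<bar> * norm (p x)" by (simp add: Q_def u_def norm_mult)
    also have "\<dots> \<le> 1 / (\<kappa> * \<bar>\<tau>\<bar>) * (A + B)"
      unfolding A_def B_def
      by (intro mult_mono rb that norm_le_integral_norm_plus_derivative[OF p p']) (use \<kappa>(1) in auto)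
    finally show ?thesis by simp
  qed
  have "norm (integral {0..1} E) \<le>
      integral {0..1} (\<lambda>x. M / (\<kappa>\<^sup>2 * \<bar>\<tau>\<bar>) * norm (p x) + 1 / (\<kappa> * \<bar>\<tau>\<bar>) * norm (p' x))"
  proof (rule Henstock_Kurzweil_Integration.integral_norm_bound_integral)
    show "E integrable_on {0..1}" by (intro integrable_continuous_interval cE)
    show "(\<lambda>x. M / (\<kappa>\<^sup>2 * \<bar>\<tau>\<bar>) * norm (p x) + 1 / (\<kappa> * \<bar>\<tau>\<bar>) * norm (p' x)) integrable_on {0..1}"
      by (intro integrable_continuous_interval continuous_intros cp cp'')
    fix x :: real assume x: "x \<in> {0..1}"
    have "norm (E x) \<le> \<bar>r' x\<bar> * norm (p x) + \<bar>r x\<bar> * norm (p' x)"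
      unfolding E_def by (rule norm_triangle_le) (simp add: u_def norm_mult)
    also have "\<dots> \<le> M / (\<kappa>\<^sup>2 * \<bar>\<tau>\<bar>) * norm (p x) + 1 / (\<kappa> * \<bar>\<tau>\<bar>) * norm (p' x)"
      by (intro add_mono mult_right_mono rb r'b x) auto
    finally show "norm (E x) \<le> M / (\<kappa>\<^sup>2 * \<bar>\<tau>\<bar>) * norm (p x) + 1 / (\<kappa> * \<bar>\<tau>\<bar>) * norm (p' x)" .
  qed
  also have "\<dots> = M / (\<kappa>\<^sup>2 * \<bar>\<tau>\<bar>) * A + 1 / (\<kappa> * \<bar>\<tau>\<bar>) * B"
    unfolding A_def B_def using \<kappa>(1) \<open>\<tau> \<noteq> 0\<close>
    by (subst Henstock_Kurzweil_Integration.integral_add)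
      (auto intro!: integrable_continuous_interval continuous_intros cp cp'')
  finally have "norm (integral {0..1} (\<lambda>x. p x * u x)) \<le>
      (A + B) / (\<kappa> * \<bar>\<tau>\<bar>) + (A + B) / (\<kappa> * \<bar>\<tau>\<bar>) + (M / (\<kappa>\<^sup>2 * \<bar>\<tau>\<bar>) * A + 1 / (\<kappa> * \<bar>\<tau>\<bar>) * B)"
    using order_trans[OF start add_mono[OF add_mono[OF Qb[of 1] Qb[of 0]]]] by simp
  also have "\<dots> = ((2 / \<kappa> + M / \<kappa>\<^sup>2) * A + 3 / \<kappa> * B) / \<bar>\<tau>\<bar>"
    using \<kappa>(1) \<open>\<tau> \<noteq> 0\<close> by (simp add: field_simps)
  finally show ?thesis by (simp add: u_def A_def B_def)
qed

lemma integral_branches: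
  fixes f :: "real \<Rightarrow> 'a::banach"
  assumes cont: "continuous_on {0..1} f" and b: "b \<ge> (1::nat)"
  shows "integral {0..1} f = (\<Sum>j<b. integral {0..1} (\<lambda>x. f ((x + real j) / real b))) /\<^sub>R real b"
proof -
  have int: "f integrable_on {u..v}" if "0 \<le> u" "v \<le> 1" for u v
    by (intro integrable_continuous_interval continuous_on_subset[OF cont]) (use that in auto)
  have one: "integral {0..1} (\<lambda>x. f ((x + real j) / b)) = real b *\<^sub>R integral {j / b..(j + 1) / b} f"
    if "j < b" for j
  proof -
    have "(f has_integral integral {j / b..(j + 1) / b} f) (cbox (j / b) ((j + 1) / b))"
      using that by (auto intro!: integrable_integral int simp: field_simps)
    from has_integral_affinity'[OF this, of "1 / b" "j / b"]
    have "((\<lambda>x. f (x / b + j / b)) has_integral (real b *\<^sub>R integral {j / b..(j + 1) / b} f))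
       (cbox ((j / b - j / b) * b) (((j + 1) / b - j / b) * b))"
      using b by (simp add: mult.commute)
    moreover have "((j + 1) / b - j / b) * b = 1" using b by (simp add: field_simps)
    ultimately show ?thesis
      by (intro integral_unique) (simp add: add_divide_distrib add.commute)
  qed
  have "(\<Sum>j<m. integral {real j / b..(j + 1) / b} f) = integral {0..m / b} f" if "m \<le> b" for m :: nat
    using that
  proof (induction m)
    case (Suc m)
    then have "(\<Sum>j<Suc m. integral {real j / b..(j + 1) / b} f)
        = integral {0..m / b} f + integral {m / b..(m + 1) / b} f" by simp
    also have "\<dots> = integral {0..(m + 1) / b} f"
      using Suc.prems b
      by (intro Henstock_Kurzweil_Integration.integral_combine int) (auto simp: field_simps)
    finally show ?case by (simp add: add.commute)
  qed simp
  from this[of b] have "(\<Sum>j<b. integral {real j / b..(j + 1) / b} f) = integral {0..1} f"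
    using b by simp
  moreover have "(\<Sum>j<b. integral {0..1} (\<lambda>x. f ((x + real j) / b)))
      = real b *\<^sub>R (\<Sum>j<b. integral {real j / b..(j + 1) / b} f)"
    by (simp add: one scaleR_sum_right add.commute)
  ultimately show ?thesis using b by simp
qed

section \<open>Weighted transfer operators\<close>

text \<open>The transfer operator of \<open>x \<mapsto> b x mod 1\<close> twisted by the phase \<open>t \<phi>\<close>. The weights \<open>a\<close> are arbitrary
so that an exponential \<open>e(\<nu>\<cdot>)\<close> can be absorbed branch by branch. Functions live on the
whole line because extracting the factor \<open>e((\<nu>/b)\<cdot>)\<close> destroys periodicity.\<close>

definition transfer :: "(real \<Rightarrow> real) \<Rightarrow> nat \<Rightarrow> (nat \<Rightarrow> complex) \<Rightarrow> real \<Rightarrow> (real \<Rightarrow> complex) \<Rightarrow> real \<Rightarrow> complex" where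
  "transfer \<phi> b a t g x = (\<Sum>j<b. a j * g ((x + real j) / b) * cis (t * \<phi> ((x + real j) / b))) / b"

definition energy :: "(real \<Rightarrow> complex) \<Rightarrow> real" where
  "energy g = integral {0..1} (\<lambda>x. (norm (g x))\<^sup>2)"

lemma energy_nonneg: "energy g \<ge> 0"
proof (cases "(\<lambda>x. (norm (g x))\<^sup>2) integrable_on {0..1}")
  case True
  then show ?thesis unfolding energy_def by (intro Henstock_Kurzweil_Integration.integral_nonneg) auto
qed (simp add: energy_def not_integrable_integral)

lemma energy_integrable:
  assumes "continuous_on UNIV g"
  shows "(\<lambda>x. (norm (g x :: complex))\<^sup>2) integrable_on {a..b::real}"
  by (intro integrable_continuous_interval continuous_intros continuous_on_subset[OF assms]) auto

lemma continuous_on_branch: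
  fixes b :: nat
  assumes "continuous_on UNIV (f :: real \<Rightarrow> 'a::topological_space)"
  shows "continuous_on S (\<lambda>x. f ((x + real j) / real b))"
  by (rule continuous_on_compose2[OF assms]) (auto intro!: continuous_intros simp: divide_inverse)

lemma continuous_on_transfer:
  assumes "continuous_on UNIV \<phi>" "continuous_on UNIV g"
  shows "continuous_on S (transfer \<phi> b a t g)"
  unfolding transfer_def divide_inverse[of "sum _ _"]
  by (intro continuous_intros continuous_on_branch assms)

lemma energy_branches:
  assumes "continuous_on UNIV g" "b \<ge> (1::nat)"
  shows "energy g = (\<Sum>j<b. energy (\<lambda>x. g ((x + real j) / real b))) / real b"
  unfolding energy_def
  by (subst integral_branches[OF _ assms(2)])
    (auto intro!: continuous_intros continuous_on_subset[OF assms(1)] simp: divide_inverse_commute)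

text \<open>Jensen's inequality on each fibre.\<close>

lemma energy_transfer_le:
  assumes "continuous_on UNIV \<phi>" "continuous_on UNIV g" "b \<ge> (1::nat)" "\<And>j. norm (a j) \<le> 1"
  shows "energy (transfer \<phi> b a t g) \<le> energy g"
proof -
  have "(norm (transfer \<phi> b a t g x))\<^sup>2 \<le> (\<Sum>j<b. (norm (g ((x + real j) / b)))\<^sup>2) / b" for x
  proof -
    have "norm (transfer \<phi> b a t g x) \<le> (\<Sum>j<b. norm (g ((x + real j) / b))) / b"
      unfolding transfer_def norm_divide using assms(4)
      by (auto intro!: divide_right_mono sum_norm_le mult_left_le_one_le simp: norm_mult)
    then have "(norm (transfer \<phi> b a t g x))\<^sup>2 \<le> ((\<Sum>j<b. norm (g ((x + real j) / b))) / b)\<^sup>2"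
      by (intro power_mono) auto
    also have "\<dots> \<le> ((\<Sum>j<b. (norm (g ((x + real j) / b)))\<^sup>2) * card {..<b}) / (real b)\<^sup>2"
      unfolding power_divide by (intro divide_right_mono sum_squared_le_sum_of_squares) auto
    finally show ?thesis using assms(3) by (simp add: power2_eq_square)
  qed
  then have "energy (transfer \<phi> b a t g) \<le> integral {0..1} (\<lambda>x. (\<Sum>j<b. (norm (g ((x + real j) / b)))\<^sup>2) / b)"
    unfolding energy_def divide_inverse[of "sum _ _"]
    by (intro integral_le energy_integrable continuous_on_transfer assms integrable_continuous_interval
        continuous_intros continuous_on_branch) auto
  also have "\<dots> = energy g"
    unfolding energy_branches[OF assms(2,3)] unfolding energy_def
    by (simp, subst Henstock_Kurzweil_Integration.integral_sum)
      (auto intro!: integrable_continuous_interval continuous_intros continuous_on_branch assms)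
  finally show ?thesis .
qed

text \<open>Differentiating a branch produces the factor \<open>1 / b\<close>, so the derivative of the image is again an
image under the operator, divided by \<open>b\<close>.\<close>

lemma transfer_has_vector_derivative:
  assumes \<phi>: "\<And>x. (\<phi> has_real_derivative \<phi>' x) (at x)"
    and g: "\<And>x. (g has_vector_derivative g' x) (at x)"
  shows "(transfer \<phi> b a t g has_vector_derivative
     transfer \<phi> b a t (\<lambda>u. g' u + \<i> * of_real (t * \<phi>' u) * g u) x / b) (at x)"
proof (cases "b = 0")
  case False
  have br: "((\<lambda>x. (x + real j) / real b) has_real_derivative 1 / b) (at x)" for j x
    using False by (auto intro!: derivative_eq_intros)
  have 1: "((\<lambda>x. cis (t * \<phi> ((x + real j) / b))) has_vector_derivative
      of_real (t * \<phi>' ((x + real j) / b) / b) * (\<i> * cis (t * \<phi> ((x + real j) / b)))) (at x)" for j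
  proof -
    have "((\<lambda>x. t * \<phi> ((x + real j) / b)) has_real_derivative t * (\<phi>' ((x + real j) / b) * (1 / b))) (at x)"
      by (intro DERIV_cmult DERIV_chain2[OF \<phi> br])
    from has_vector_derivative_cis[OF this] show ?thesis by simp
  qed
  have 2: "((\<lambda>x. g ((x + real j) / b)) has_vector_derivative (1 / b) *\<^sub>R g' ((x + real j) / b)) (at x)" for j
    using vector_diff_chain_at[OF br[unfolded has_real_derivative_iff_has_vector_derivative] g]
    by (simp add: o_def)
  have 3: "((\<lambda>x. a j * g ((x + real j) / b) * cis (t * \<phi> ((x + real j) / b))) has_vector_derivative
     a j * (g' ((x + real j) / b) + \<i> * of_real (t * \<phi>' ((x + real j) / b)) * g ((x + real j) / b))
        * cis (t * \<phi> ((x + real j) / b)) / b) (at x)" for j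
  proof -
    have "((\<lambda>x. a j * g ((x + real j) / b) * cis (t * \<phi> ((x + real j) / b))) has_vector_derivative
      a j * g ((x + real j) / b) * (of_real (t * \<phi>' ((x + real j) / b) / b) * (\<i> * cis (t * \<phi> ((x + real j) / b))))
      + a j * ((1 / b) *\<^sub>R g' ((x + real j) / b)) * cis (t * \<phi> ((x + real j) / b))) (at x)"
      by (intro has_vector_derivative_mult has_vector_derivative_mult_right 1 2)
    then show ?thesis using False by (simp add: scaleR_conv_of_real field_simps)
  qed
  have "((\<lambda>x. (\<Sum>j<b. a j * g ((x + real j) / b) * cis (t * \<phi> ((x + real j) / b))) / b) has_vector_derivative
    (\<Sum>j<b. a j * (g' ((x + real j) / b) + \<i> * of_real (t * \<phi>' ((x + real j) / b)) * g ((x + real j) / b))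
        * cis (t * \<phi> ((x + real j) / b)) / b) / b) (at x)"
    by (intro has_vector_derivative_divide has_vector_derivative_sum 3)
  then show ?thesis by (simp add: transfer_def[abs_def] sum_divide_distrib)
qed (simp add: transfer_def[abs_def])

lemma pair_integral_trivial:
  fixes f g w :: "real \<Rightarrow> complex"
  assumes "continuous_on UNIV f" "continuous_on UNIV g" "continuous_on UNIV w" "\<And>x. norm (w x) = 1"
  shows "norm (integral {0..1} (\<lambda>x. f x * cnj (g x) * w x)) \<le> (energy f + energy g) / 2"
    and "integral {0..1} (\<lambda>x. norm (f x * cnj (g x))) \<le> (energy f + energy g) / 2"
proof -
  have le: "norm (f x * cnj (g x)) \<le> ((norm (f x))\<^sup>2 + (norm (g x))\<^sup>2) / 2" for x
    using sum_squares_bound[of "norm (f x)" "norm (g x)"] by (simp add: norm_mult)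
  have eq: "integral {0..1} (\<lambda>x. ((norm (f x))\<^sup>2 + (norm (g x))\<^sup>2) / 2) = (energy f + energy g) / 2"
    unfolding energy_def
    by (simp, subst Henstock_Kurzweil_Integration.integral_add) (auto intro!: energy_integrable assms)
  have int: "(\<lambda>x. ((norm (f x))\<^sup>2 + (norm (g x))\<^sup>2) / 2) integrable_on {0..1}"
    unfolding divide_inverse
    by (intro integrable_continuous_interval continuous_intros continuous_on_subset[OF assms(1)]
        continuous_on_subset[OF assms(2)]) auto
  have c: "continuous_on {0..1} f" "continuous_on {0..1} g" "continuous_on {0..1} w"
    using assms by (auto intro: continuous_on_subset)
  have "norm (integral {0..1} (\<lambda>x. f x * cnj (g x) * w x))
      \<le> integral {0..1} (\<lambda>x. ((norm (f x))\<^sup>2 + (norm (g x))\<^sup>2) / 2)"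
    by (intro Henstock_Kurzweil_Integration.integral_norm_bound_integral int)
      (use le in \<open>auto intro!: integrable_continuous_interval continuous_intros c simp: norm_mult assms(4)\<close>)
  then show "norm (integral {0..1} (\<lambda>x. f x * cnj (g x) * w x)) \<le> (energy f + energy g) / 2"
    by (simp only: eq)
  have "integral {0..1} (\<lambda>x. norm (f x * cnj (g x)))
      \<le> integral {0..1} (\<lambda>x. ((norm (f x))\<^sup>2 + (norm (g x))\<^sup>2) / 2)"
    by (intro integral_le int le) (auto intro!: integrable_continuous_interval continuous_intros c)
  then show "integral {0..1} (\<lambda>x. norm (f x * cnj (g x))) \<le> (energy f + energy g) / 2"
    by (simp only: eq)
qed

lemma energy_cmult: "energy (\<lambda>x. of_real c * g x) = c\<^sup>2 * energy g"
  by (simp add: energy_def norm_mult power_mult_distrib)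

text \<open>The free parameter \<open>R\<close> balances \<open>\<parallel>g'\<parallel>\<close>, of natural size \<open>\<bar>t\<bar> / sqrt b\<close>, against \<open>\<parallel>g\<parallel>\<close>.\<close>

lemma integral_norm_mult_le_weighted:
  fixes f g :: "real \<Rightarrow> complex"
  assumes "continuous_on UNIV f" "continuous_on UNIV g" "R > 0"
  shows "integral {0..1} (\<lambda>x. norm (f x * cnj (g x))) \<le> (energy f / R + R * energy g) / 2"
proof -
  define s where "s = sqrt R"
  have s: "s > 0" "s\<^sup>2 = R" using assms(3) by (auto simp: s_def)
  have "integral {0..1} (\<lambda>x. norm (f x * cnj (g x)))
      = integral {0..1} (\<lambda>x. norm ((of_real (1 / s) * f x) * cnj (of_real s * g x)))"
    using s(1) by (simp add: norm_mult)
  also have "\<dots> \<le> (energy (\<lambda>x. of_real (1 / s) * f x) + energy (\<lambda>x. of_real s * g x)) / 2"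
    by (intro pair_integral_trivial(2)[where w = "\<lambda>_. 1"] continuous_intros assms) auto
  finally show ?thesis
    unfolding energy_cmult power_divide s(2) by simp
qed

text \<open>Schur test for a symmetric 0-1 kernel: by symmetry both halves of \<open>X j + X k\<close> contribute the same,
and each row has at most \<open>M\<close> entries.\<close>

lemma double_sum_near_le:
  fixes X :: "nat \<Rightarrow> real" and M :: real
  assumes X: "\<And>j. X j \<ge> 0" and sym: "\<And>j k. near j k \<longleftrightarrow> near k j"
    and M: "\<And>j. j < b \<Longrightarrow> real (card {k. k < b \<and> near j k}) \<le> M"
  shows "(\<Sum>j<b. \<Sum>k<b. if near j k then (X j + X k) / 2 else 0) \<le> M * (\<Sum>j<b. X j)"
proof -
  have 1: "(\<Sum>j<b. \<Sum>k<b. if near j k then X j else 0) \<le> M * (\<Sum>j<b. X j)"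
  proof -
    have "(\<Sum>k<b. if near j k then X j else 0) = card {k. k < b \<and> near j k} * X j" for j
      by (simp add: sum.If_cases Collect_conj_eq lessThan_def)
    then show ?thesis
      by (auto simp: sum_distrib_left intro!: sum_mono mult_right_mono M X)
  qed
  have "(\<Sum>j<b. \<Sum>k<b. if near j k then X k else 0) = (\<Sum>j<b. \<Sum>k<b. if near j k then X j else 0)"
    by (subst sum.swap) (simp add: sym)
  moreover have "(\<Sum>j<b. \<Sum>k<b. if near j k then (X j + X k) / 2 else 0)
      = ((\<Sum>j<b. \<Sum>k<b. if near j k then X j else 0) + (\<Sum>j<b. \<Sum>k<b. if near j k then X k else 0)) / 2"
    unfolding sum.distrib[symmetric] sum_divide_distrib by (intro sum.cong refl) auto
  ultimately show ?thesis using 1 by simp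
qed

lemma energy_transfer_eq_double_sum:
  assumes c\<phi>: "continuous_on UNIV \<phi>" and cg: "continuous_on UNIV g"
  shows "complex_of_real (energy (transfer \<phi> b a t g)) =
    (\<Sum>j<b. \<Sum>k<b. (a j * cnj (a k) / of_nat b ^ 2) * integral {0..1} (\<lambda>x.
      g ((x + real j) / b) * cnj (g ((x + real k) / b)) *
      cis (t * (\<phi> ((x + real j) / b) - \<phi> ((x + real k) / b)))))"
    (is "_ = (\<Sum>j<b. \<Sum>k<b. _ * integral {0..1} (?F j k))")
proof -
  let ?T = "transfer \<phi> b a t g"
  have cont: "continuous_on {0..1} (?F j k)" for j k
    by (intro continuous_intros continuous_on_branch cg c\<phi>)
  have "((\<lambda>x. \<Sum>j<b. \<Sum>k<b. (a j * cnj (a k) / of_nat b ^ 2) * ?F j k x) has_integral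
      (\<Sum>j<b. \<Sum>k<b. (a j * cnj (a k) / of_nat b ^ 2) * integral {0..1} (?F j k))) {0..1}"
    by (intro has_integral_sum has_integral_mult_right integrable_integral finite_lessThan
        integrable_continuous_interval cont)
  moreover have "(\<Sum>j<b. \<Sum>k<b. (a j * cnj (a k) / of_nat b ^ 2) * ?F j k x)
      = of_real ((norm (?T x))\<^sup>2)" for x
  proof -
    define c where "c j = a j * g ((x + real j) / b) * cis (t * \<phi> ((x + real j) / b))" for j
    have "of_real ((norm (?T x))\<^sup>2) = ?T x * cnj (?T x)" by (rule complex_norm_square)
    also have "\<dots> = (\<Sum>j<b. c j) * (\<Sum>k<b. cnj (c k)) / of_nat b ^ 2"
      by (simp add: transfer_def c_def power2_eq_square)
    also have "\<dots> = (\<Sum>j<b. \<Sum>k<b. c j * cnj (c k) / of_nat b ^ 2)"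
      by (simp add: sum_product sum_divide_distrib)
    also have "\<dots> = (\<Sum>j<b. \<Sum>k<b. (a j * cnj (a k) / of_nat b ^ 2) * ?F j k x)"
      by (simp add: c_def cis_cnj cis_mult[symmetric] right_diff_distrib diff_conv_add_uminus[of "t * _"]
          mult_ac del: add_uminus_conv_diff)
    finally show ?thesis by simp
  qed
  ultimately have 1: "((\<lambda>x. complex_of_real ((norm (?T x))\<^sup>2)) has_integral
      (\<Sum>j<b. \<Sum>k<b. (a j * cnj (a k) / of_nat b ^ 2) * integral {0..1} (?F j k))) {0..1}"
    by simp
  have 2: "((\<lambda>x. complex_of_real ((norm (?T x))\<^sup>2)) has_integral of_real (energy ?T)) {0..1}"
    unfolding energy_def
    by (intro has_integral_of_real integrable_integral energy_integrable continuous_on_transfer assms)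
  show ?thesis by (rule has_integral_unique[OF 2 1])
qed

text \<open>A pair of branches whose slopes differ. The phase difference has derivative at least
\<open>\<delta> / (2 b)\<close> and second derivative at most \<open>2 C / b\<^sup>2\<close>, and differentiating the amplitude gains
\<open>1 / b\<close>; these powers of \<open>b\<close> produce the constants.\<close>

lemma pair_integral_transversal:
  fixes \<phi> \<phi>' \<phi>'' :: "real \<Rightarrow> real" and g g' :: "real \<Rightarrow> complex" and \<delta> C R t :: real and b j k :: nat
  assumes \<phi>: "\<And>x. (\<phi> has_real_derivative \<phi>' x) (at x)" "\<And>x. (\<phi>' has_real_derivative \<phi>'' x) (at x)"
    and \<phi>'': "continuous_on UNIV \<phi>''" "\<And>x. x \<in> {0..1} \<Longrightarrow> \<bar>\<phi>'' x\<bar> \<le> C"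
    and g: "\<And>x. (g has_vector_derivative g' x) (at x)" "continuous_on UNIV g'"
    and jk: "j < b" "k < b" and trans: "\<bar>\<phi>' (j / b) - \<phi>' (k / b)\<bar> > \<delta>"
    and \<delta>: "\<delta> > 0" "4 * C / b \<le> \<delta>" and "t \<noteq> 0" "R > 0"
  shows "norm (integral {0..1} (\<lambda>x. g ((x + real j) / b) * cnj (g ((x + real k) / b)) *
      cis (t * (\<phi> ((x + real j) / b) - \<phi> ((x + real k) / b))))) \<le>
    ((2 * b / \<delta> + 4 * C / \<delta>\<^sup>2 + 3 * R / \<delta>) * (energy (\<lambda>x. g ((x + real j) / b)) + energy (\<lambda>x. g ((x + real k) / b)))
     + 3 / (\<delta> * R) * (energy (\<lambda>x. g' ((x + real j) / b)) + energy (\<lambda>x. g' ((x + real k) / b)))) / \<bar>t\<bar>"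
proof -
  have b: "real b > 0" using jk by simp
  have C0: "C \<ge> 0" using \<phi>''(2)[of 0] by simp
  have br: "((\<lambda>x. (x + real i) / real b) has_real_derivative 1 / b) (at x)" for i x
    using b by (auto intro!: derivative_eq_intros)
  have cg: "continuous_on S g" for S
    using g(1) by (intro continuous_at_imp_continuous_on) (auto intro: has_vector_derivative_continuous)
  define G where "G i = (\<lambda>x. g ((x + real i) / b))" for i
  define G' where "G' i = (\<lambda>x. g' ((x + real i) / b))" for i
  have cG: "continuous_on S (G i)" "continuous_on S (G' i)" for i S
    unfolding G_def G'_def by (intro continuous_on_branch cg g)+
  have dG: "(G i has_vector_derivative (1 / b) *\<^sub>R G' i x) (at x)" for i x
    unfolding G_def G'_def
    using vector_diff_chain_at[OF br[unfolded has_real_derivative_iff_has_vector_derivative] g(1)]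
    by (simp add: o_def)
  define p where "p = (\<lambda>x. G j x * cnj (G k x))"
  define p' where "p' = (\<lambda>x. G j x * cnj ((1 / b) *\<^sub>R G' k x) + ((1 / b) *\<^sub>R G' j x) * cnj (G k x))"
  have dp: "(p has_vector_derivative p' x) (at x)" for x
    unfolding p_def p'_def by (intro has_vector_derivative_mult has_vector_derivative_cnj dG)
  have cp': "continuous_on UNIV p'" unfolding p'_def by (intro continuous_intros cG)
  define \<psi> where "\<psi> = (\<lambda>x. \<phi> ((x + real j) / b) - \<phi> ((x + real k) / b))"
  define \<psi>' where "\<psi>' = (\<lambda>x. (\<phi>' ((x + real j) / b) - \<phi>' ((x + real k) / b)) / b)"
  define \<psi>'' where "\<psi>'' = (\<lambda>x. (\<phi>'' ((x + real j) / b) - \<phi>'' ((x + real k) / b)) / b\<^sup>2)"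
  have d\<psi>: "(\<psi> has_real_derivative \<psi>' x) (at x)" for x
  proof -
    have "(\<psi> has_real_derivative \<phi>' ((x + real j) / b) * (1 / b) - \<phi>' ((x + real k) / b) * (1 / b)) (at x)"
      unfolding \<psi>_def by (intro DERIV_diff DERIV_chain2[OF \<phi>(1) br])
    then show ?thesis by (simp add: \<psi>'_def diff_divide_distrib)
  qed
  have d\<psi>': "(\<psi>' has_real_derivative \<psi>'' x) (at x)" for x
  proof -
    have "(\<psi>' has_real_derivative (\<phi>'' ((x + real j) / b) * (1 / b) - \<phi>'' ((x + real k) / b) * (1 / b)) / b) (at x)"
      unfolding \<psi>'_def by (intro DERIV_cdivide DERIV_diff DERIV_chain2[OF \<phi>(2) br])
    then show ?thesis by (simp add: \<psi>''_def diff_divide_distrib power2_eq_square)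
  qed
  have c\<psi>'': "continuous_on UNIV \<psi>''"
    unfolding \<psi>''_def using b
    by (auto intro!: continuous_on_divide continuous_on_diff continuous_on_const
        continuous_on_branch[OF \<phi>''(1)])
  have mem: "(x + real i) / b \<in> {0..1}" if "x \<in> {0..1}" "i < b" for x i
    using that b by (auto simp: field_simps)
  \<comment> \<open>Moving \<open>x\<close> across the unit interval changes each \<open>\<phi>'\<close> by at most \<open>C / b \<le> \<delta> / 4\<close>,
    so transversality at the left end points survives, up to a factor 2, on the whole branch.\<close>
  have drift: "\<bar>\<phi>' ((x + real i) / b) - \<phi>' (i / b)\<bar> \<le> \<delta> / 4" if "x \<in> {0..1}" "i < b" for x i
  proof -
    have "norm (\<phi>' ((x + real i) / b) - \<phi>' (i / b)) \<le> C * norm ((x + real i) / b - i / b)"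
    proof (rule field_differentiable_bound[where S = "{0..1}"])
      show "(\<phi>' has_field_derivative \<phi>'' z) (at z within {0..1})" for z
        by (rule has_field_derivative_at_within[OF \<phi>(2)])
      show "real i / b \<in> {0..1}" using mem[of 0 i] that by simp
    qed (use \<phi>''(2) mem[OF that] in auto)
    also have "(x + real i) / b - i / b = x / b" by (simp add: add_divide_distrib)
    also have "C * norm (x / b) \<le> C * (1 / b)"
      using that b C0 by (intro mult_left_mono) (auto simp: divide_right_mono)
    finally show ?thesis using \<delta>(2) by simp
  qed
  have \<kappa>: "\<delta> / (2 * b) \<le> \<bar>\<psi>' x\<bar>" if "x \<in> {0..1}" for x
  proof -
    have "\<delta> / 2 \<le> \<bar>\<phi>' ((x + real j) / b) - \<phi>' ((x + real k) / b)\<bar>"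
      using drift[OF that jk(1)] drift[OF that jk(2)] trans by linarith
    then have "\<delta> / 2 / b \<le> \<bar>\<phi>' ((x + real j) / b) - \<phi>' ((x + real k) / b)\<bar> / b"
      using b by (intro divide_right_mono) auto
    then show ?thesis using b by (simp add: \<psi>'_def)
  qed
  have M: "\<bar>\<psi>'' x\<bar> \<le> 2 * C / b\<^sup>2" if "x \<in> {0..1}" for x
  proof -
    have "\<bar>\<phi>'' ((x + real j) / b) - \<phi>'' ((x + real k) / b)\<bar> \<le> 2 * C"
      using \<phi>''(2)[OF mem[OF that jk(1)]] \<phi>''(2)[OF mem[OF that jk(2)]] by linarith
    then show ?thesis by (simp add: \<psi>''_def divide_right_mono)
  qed
  define X where "X i = energy (G i)" for i
  define Y where "Y i = energy (G' i)" for i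
  have P: "integral {0..1} (\<lambda>x. norm (p x)) \<le> (X j + X k) / 2"
    unfolding p_def X_def by (rule pair_integral_trivial(2)[where w = "\<lambda>_. 1"]) (auto intro: cG)
  have P': "integral {0..1} (\<lambda>x. norm (p' x)) \<le> (R * (X j + X k) + (Y j + Y k) / R) / (2 * b)"
  proof -
    have "integral {0..1} (\<lambda>x. norm (p' x)) \<le>
       integral {0..1} (\<lambda>x. (1 / b) * norm (G' k x * cnj (G j x)) + (1 / b) * norm (G' j x * cnj (G k x)))"
    proof (rule integral_le)
      fix x :: real
      show "norm (p' x) \<le> (1 / b) * norm (G' k x * cnj (G j x)) + (1 / b) * norm (G' j x * cnj (G k x))"
        unfolding p'_def by (rule norm_triangle_le) (simp add: norm_mult mult.commute)
    qed (use b in \<open>auto intro!: integrable_continuous_interval continuous_intros cG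
        continuous_on_subset[OF cp']\<close>)
    also have "\<dots> = (1 / b) * integral {0..1} (\<lambda>x. norm (G' k x * cnj (G j x)))
        + (1 / b) * integral {0..1} (\<lambda>x. norm (G' j x * cnj (G k x)))"
      using b by (subst Henstock_Kurzweil_Integration.integral_add)
        (auto intro!: integrable_continuous_interval continuous_intros cG simp del: norm_mult)
    also have "\<dots> \<le> (1 / b) * ((Y k / R + R * X j) / 2) + (1 / b) * ((Y j / R + R * X k) / 2)"
      unfolding X_def Y_def using b
      by (intro add_mono mult_left_mono integral_norm_mult_le_weighted cG \<open>R > 0\<close>) auto
    also have "\<dots> = (R * (X j + X k) + (Y j + Y k) / R) / (2 * b)"
      using b \<open>R > 0\<close> by (simp add: field_simps)
    finally show ?thesis .
  qed
  have "norm (integral {0..1} (\<lambda>x. p x * cis (t * \<psi> x))) \<le>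
    ((2 / (\<delta> / (2 * b)) + (2 * C / b\<^sup>2) / (\<delta> / (2 * b))\<^sup>2) * integral {0..1} (\<lambda>x. norm (p x))
      + 3 / (\<delta> / (2 * b)) * integral {0..1} (\<lambda>x. norm (p' x))) / \<bar>t\<bar>"
    by (rule nonstationary_phase[OF dp cp' d\<psi> d\<psi>' c\<psi>'' _ \<kappa> M \<open>t \<noteq> 0\<close>]) (use \<delta> b in auto)
  also have "\<dots> \<le> ((2 / (\<delta> / (2 * b)) + (2 * C / b\<^sup>2) / (\<delta> / (2 * b))\<^sup>2) * ((X j + X k) / 2)
      + 3 / (\<delta> / (2 * b)) * ((R * (X j + X k) + (Y j + Y k) / R) / (2 * b))) / \<bar>t\<bar>"
    using \<delta> b C0 by (intro divide_right_mono add_mono mult_left_mono P P') auto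
  also have "(2 / (\<delta> / (2 * b)) + (2 * C / b\<^sup>2) / (\<delta> / (2 * b))\<^sup>2) * ((X j + X k) / 2)
      + 3 / (\<delta> / (2 * b)) * ((R * (X j + X k) + (Y j + Y k) / R) / (2 * b))
    = (2 * b / \<delta> + 4 * C / \<delta>\<^sup>2 + 3 * R / \<delta>) * (X j + X k) + 3 / (\<delta> * R) * (Y j + Y k)"
    using \<delta> b \<open>R > 0\<close> by (simp add: field_simps power2_eq_square)
  finally show ?thesis by (simp add: p_def \<psi>_def X_def Y_def G_def G'_def)
qed

text \<open>Near pairs of branches are estimated trivially and counted, all others oscillate. The first term
on the right is a gain as soon as \<open>M\<close> is a smaller power of \<open>b\<close> than the first.\<close>

lemma energy_transfer_schur:
  fixes \<phi> \<phi>' \<phi>'' :: "real \<Rightarrow> real" and g g' :: "real \<Rightarrow> complex" and \<delta> C R t M :: real and b :: nat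
  assumes \<phi>: "\<And>x. (\<phi> has_real_derivative \<phi>' x) (at x)" "\<And>x. (\<phi>' has_real_derivative \<phi>'' x) (at x)"
    and \<phi>'': "continuous_on UNIV \<phi>''" "\<And>x. x \<in> {0..1} \<Longrightarrow> \<bar>\<phi>'' x\<bar> \<le> C"
    and g: "\<And>x. (g has_vector_derivative g' x) (at x)" "continuous_on UNIV g'"
    and a: "\<And>j. norm (a j) \<le> 1" and b: "b \<ge> 1"
    and M: "\<And>j. j < b \<Longrightarrow> real (card {k. k < b \<and> \<bar>\<phi>' (j / b) - \<phi>' (k / b)\<bar> \<le> \<delta>}) \<le> M"
    and \<delta>: "\<delta> > 0" "4 * C / b \<le> \<delta>" and "t \<noteq> 0" "R > 0"
  shows "energy (transfer \<phi> b a t g) \<le> M / b * energy g +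
    ((4 * b / \<delta> + 8 * C / \<delta>\<^sup>2 + 6 * R / \<delta>) * energy g + 6 / (\<delta> * R) * energy g') / \<bar>t\<bar>"
proof -
  define X where "X j = energy (\<lambda>x. g ((x + real j) / b))" for j
  define Y where "Y j = energy (\<lambda>x. g' ((x + real j) / b))" for j
  define P where "P j k = integral {0..1} (\<lambda>x. g ((x + real j) / b) * cnj (g ((x + real k) / b)) *
      cis (t * (\<phi> ((x + real j) / b) - \<phi> ((x + real k) / b))))" for j k
  define near where "near j k \<longleftrightarrow> \<bar>\<phi>' (real j / b) - \<phi>' (real k / b)\<bar> \<le> \<delta>" for j k
  define \<alpha> where "\<alpha> = (2 * b / \<delta> + 4 * C / \<delta>\<^sup>2 + 3 * R / \<delta>) / \<bar>t\<bar>"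
  define \<beta> where "\<beta> = 3 / (\<delta> * R) / \<bar>t\<bar>"
  have C0: "C \<ge> 0" using \<phi>''(2)[of 0] by simp
  have XY: "X j \<ge> 0" "Y j \<ge> 0" for j by (simp_all add: X_def Y_def energy_nonneg)
  have \<alpha>\<beta>: "\<alpha> \<ge> 0" "\<beta> \<ge> 0" using \<delta> C0 \<open>R > 0\<close> by (auto simp: \<alpha>_def \<beta>_def)
  have cg: "continuous_on S g" for S
    using g(1) by (intro continuous_at_imp_continuous_on) (auto intro: has_vector_derivative_continuous)
  have c\<phi>: "continuous_on S \<phi>" for S
    using \<phi>(1) by (auto intro!: continuous_at_imp_continuous_on DERIV_isCont)
  have bound: "norm (P j k) \<le> (if near j k then (X j + X k) / 2 else 0) + (\<alpha> * (X j + X k) + \<beta> * (Y j + Y k))"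
    if "j < b" "k < b" for j k
  proof (cases "near j k")
    case True
    have "norm (P j k) \<le> (X j + X k) / 2"
      unfolding P_def X_def
      by (rule pair_integral_trivial(1)) (auto intro!: continuous_intros continuous_on_branch cg c\<phi>)
    moreover have "0 \<le> \<alpha> * (X j + X k) + \<beta> * (Y j + Y k)" using XY \<alpha>\<beta> by simp
    ultimately show ?thesis unfolding if_P[OF True] by linarith
  next
    case False
    have "norm (P j k) \<le> ((2 * b / \<delta> + 4 * C / \<delta>\<^sup>2 + 3 * R / \<delta>) * (X j + X k)
        + 3 / (\<delta> * R) * (Y j + Y k)) / \<bar>t\<bar>"
      unfolding P_def X_def Y_def
      by (rule pair_integral_transversal[OF \<phi> \<phi>'' g that])
        (use False \<delta> \<open>t \<noteq> 0\<close> \<open>R > 0\<close> in \<open>auto simp: near_def\<close>)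
    moreover have "(p * u + q * v) / w = p / w * u + q / w * v" for p q u v w :: real
      by (simp add: add_divide_distrib)
    ultimately show ?thesis using False by (simp only: \<alpha>_def \<beta>_def if_False add_0)
  qed
  have dbl: "(\<Sum>j<b. \<Sum>k<b. c * (Z j + Z k)) = 2 * b * c * (\<Sum>j<b. Z j)" for c :: real and Z :: "nat \<Rightarrow> real"
    by (simp add: sum.distrib sum_distrib_left[symmetric] algebra_simps)
  have EX: "(\<Sum>j<b. X j) = b * energy g" and EY: "(\<Sum>j<b. Y j) = b * energy g'"
    using energy_branches[OF cg b] energy_branches[OF g(2) b] b by (auto simp: X_def Y_def)
  have "energy (transfer \<phi> b a t g) = norm (complex_of_real (energy (transfer \<phi> b a t g)))"
    by (simp add: energy_nonneg)
  also have "\<dots> = norm (\<Sum>j<b. \<Sum>k<b. (a j * cnj (a k) / of_nat b ^ 2) * P j k)"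
    unfolding P_def by (subst energy_transfer_eq_double_sum[OF c\<phi> cg]) simp
  also have "\<dots> \<le> (\<Sum>j<b. \<Sum>k<b. norm (P j k) / b\<^sup>2)"
  proof (intro sum_norm_le)
    fix j k
    have "norm (a j) * norm (a k) * norm (P j k) \<le> 1 * norm (P j k)"
      by (intro mult_right_mono mult_le_one a) auto
    then show "norm ((a j * cnj (a k) / of_nat b ^ 2) * P j k) \<le> norm (P j k) / b\<^sup>2"
      by (simp add: norm_mult norm_divide norm_power divide_right_mono)
  qed
  also have "\<dots> = (\<Sum>j<b. \<Sum>k<b. norm (P j k)) / b\<^sup>2" by (simp add: sum_divide_distrib)
  also have "\<dots> \<le> (\<Sum>j<b. \<Sum>k<b. (if near j k then (X j + X k) / 2 else 0)
      + (\<alpha> * (X j + X k) + \<beta> * (Y j + Y k))) / b\<^sup>2"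
    by (intro divide_right_mono sum_mono bound) auto
  also have "\<dots> = ((\<Sum>j<b. \<Sum>k<b. (if near j k then (X j + X k) / 2 else 0))
      + (2 * b * \<alpha> * (\<Sum>j<b. X j) + 2 * b * \<beta> * (\<Sum>j<b. Y j))) / b\<^sup>2"
    by (simp only: sum.distrib dbl)
  also have "\<dots> \<le> (M * (\<Sum>j<b. X j) + (2 * b * \<alpha> * (\<Sum>j<b. X j) + 2 * b * \<beta> * (\<Sum>j<b. Y j))) / b\<^sup>2"
    using M by (intro divide_right_mono add_right_mono double_sum_near_le XY)
      (auto simp: near_def abs_minus_commute)
  also have "\<dots> = M / b * energy g + (2 * \<alpha> * energy g + 2 * \<beta> * energy g')"
    using b unfolding EX EY by (simp add: field_simps power2_eq_square)
  also have "\<dots> = M / b * energy g +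
    ((4 * b / \<delta> + 8 * C / \<delta>\<^sup>2 + 6 * R / \<delta>) * energy g + 6 / (\<delta> * R) * energy g') / \<bar>t\<bar>"
    unfolding \<alpha>_def \<beta>_def using \<delta> \<open>R > 0\<close> \<open>t \<noteq> 0\<close> by (simp add: field_simps)
  finally show ?thesis .
qed

section \<open>The one-step contraction\<close>

text \<open>The functions produced by iterating the operator have derivatives of size about \<open>\<bar>t\<bar>\<close> divided by a
power of \<open>b\<close>. The weight \<open>b / t\<^sup>2\<close> is large enough for the derivative to be negligible in the
non-stationary phase estimate and small enough to contract itself.\<close>

definition scaled_energy :: "nat \<Rightarrow> real \<Rightarrow> (real \<Rightarrow> complex) \<Rightarrow> (real \<Rightarrow> complex) \<Rightarrow> real" where
  "scaled_energy b t g g' = energy g + real b / t\<^sup>2 * energy g'"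

lemma energy_phase_derivative_le:
  fixes \<phi>' :: "real \<Rightarrow> real" and C t :: real
  assumes "continuous_on UNIV \<phi>'" "continuous_on UNIV g" "continuous_on UNIV g'"
    and "\<And>x. x \<in> {0..1} \<Longrightarrow> \<bar>\<phi>' x\<bar> \<le> C"
  shows "energy (\<lambda>u. g' u + \<i> * of_real (t * \<phi>' u) * g u) \<le> 2 * energy g' + 2 * (t * C)\<^sup>2 * energy g"
proof -
  have "energy (\<lambda>u. g' u + \<i> * of_real (t * \<phi>' u) * g u)
      \<le> integral {0..1} (\<lambda>u. 2 * (norm (g' u))\<^sup>2 + 2 * (t * C)\<^sup>2 * (norm (g u))\<^sup>2)"
    unfolding energy_def
  proof (rule integral_le)
    show "(\<lambda>u. (cmod (g' u + \<i> * complex_of_real (t * \<phi>' u) * g u))\<^sup>2) integrable_on {0..1}"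
      by (intro energy_integrable continuous_intros assms)
    show "(\<lambda>u. 2 * (norm (g' u))\<^sup>2 + 2 * (t * C)\<^sup>2 * (norm (g u))\<^sup>2) integrable_on {0..1}"
      by (intro integrable_continuous_interval continuous_intros continuous_on_subset[OF assms(2)]
          continuous_on_subset[OF assms(3)]) auto
    fix u :: real assume u: "u \<in> {0..1}"
    have "norm (g' u + \<i> * of_real (t * \<phi>' u) * g u) \<le> norm (g' u) + \<bar>t\<bar> * C * norm (g u)"
      using assms(4)[OF u]
      by (intro norm_triangle_le add_left_mono) (auto simp: norm_mult abs_mult intro!: mult_right_mono mult_left_mono)
    then have "(norm (g' u + \<i> * of_real (t * \<phi>' u) * g u))\<^sup>2 \<le> (norm (g' u) + \<bar>t\<bar> * C * norm (g u))\<^sup>2"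
      by (intro power_mono) auto
    also have "\<dots> \<le> 2 * (norm (g' u))\<^sup>2 + 2 * (\<bar>t\<bar> * C * norm (g u))\<^sup>2"
      using sum_squares_bound[of "norm (g' u)" "\<bar>t\<bar> * C * norm (g u)"] by (simp add: power2_sum)
    finally show "(norm (g' u + \<i> * of_real (t * \<phi>' u) * g u))\<^sup>2
        \<le> 2 * (norm (g' u))\<^sup>2 + 2 * (t * C)\<^sup>2 * (norm (g u))\<^sup>2"
      by (simp add: power_mult_distrib mult.assoc)
  qed
  also have "\<dots> = 2 * energy g' + 2 * (t * C)\<^sup>2 * energy g"
    unfolding energy_def
    by (subst Henstock_Kurzweil_Integration.integral_add)
      (auto intro!: integrable_continuous_interval continuous_intros continuous_on_subset[OF assms(2)]
          continuous_on_subset[OF assms(3)])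
  finally show ?thesis .
qed

text \<open>The first three terms of the rate control \<open>\<parallel>T g\<parallel>\<^sup>2\<close> and come from near pairs, from the amplitude
and from the derivative of the amplitude. The last one controls the derivative of \<open>T g\<close>: the
branches give \<open>1 / b\<^sup>2\<close>, against the weight \<open>b\<close> and a factor \<open>1 / \<mu>\<^sup>2\<close> lost by passing from \<open>t\<close> to \<open>\<mu> t\<close>.\<close>

lemma transfer_contraction:
  fixes \<phi> \<phi>' \<phi>'' :: "real \<Rightarrow> real" and g g' :: "real \<Rightarrow> complex" and \<delta> C C' t M \<mu> q :: real and b :: nat
  assumes \<phi>: "\<And>x. (\<phi> has_real_derivative \<phi>' x) (at x)" "\<And>x. (\<phi>' has_real_derivative \<phi>'' x) (at x)"
    and \<phi>'': "continuous_on UNIV \<phi>''" "\<And>x. x \<in> {0..1} \<Longrightarrow> \<bar>\<phi>'' x\<bar> \<le> C"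
    and C': "\<And>x. x \<in> {0..1} \<Longrightarrow> \<bar>\<phi>' x\<bar> \<le> C'"
    and g: "\<And>x. (g has_vector_derivative g' x) (at x)" "continuous_on UNIV g'"
    and a: "\<And>j. norm (a j) \<le> 1" and b: "b \<ge> 1"
    and M: "\<And>j. j < b \<Longrightarrow> real (card {k. k < b \<and> \<bar>\<phi>' (j / b) - \<phi>' (k / b)\<bar> \<le> \<delta>}) \<le> M"
    and \<delta>: "\<delta> > 0" "4 * C / b \<le> \<delta>" and t: "\<bar>t\<bar> \<ge> real b ^ 2" and "\<mu> > 0"
    and q: "M / b + (4 * b / \<delta> + 8 * C / \<delta>\<^sup>2) / real b ^ 2 + 6 / (\<delta> * sqrt b)
      + 2 * (1 + C'\<^sup>2) / (b * \<mu>\<^sup>2) \<le> q"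
  shows "scaled_energy b (\<mu> * t) (transfer \<phi> b a t g)
      (\<lambda>x. transfer \<phi> b a t (\<lambda>u. g' u + \<i> * of_real (t * \<phi>' u) * g u) x / b)
    \<le> q * scaled_energy b t g g'"
proof -
  have b0: "real b \<ge> 1" using b by simp
  have tp: "\<bar>t\<bar> \<ge> 1" using t one_le_power[OF b0, of 2] by linarith
  have t0: "t \<noteq> 0" using tp by auto
  have C0: "C \<ge> 0" using \<phi>''(2)[of 0] by simp
  have M0: "M \<ge> 0" using order_trans[OF _ M[of 0]] b by simp
  have cg: "continuous_on S g" for S
    using g(1) by (intro continuous_at_imp_continuous_on) (auto intro: has_vector_derivative_continuous)
  have c\<phi>: "continuous_on S \<phi>" "continuous_on S \<phi>'" for S
    using \<phi> by (auto intro!: continuous_at_imp_continuous_on DERIV_isCont)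
  define h where "h = (\<lambda>u. g' u + \<i> * of_real (t * \<phi>' u) * g u)"
  define V where "V = scaled_energy b t g g'"
  have E: "energy g \<ge> 0" "energy g' \<ge> 0" by (rule energy_nonneg)+
  have V: "energy g \<le> V" "real b / t\<^sup>2 * energy g' \<le> V" "energy g' / t\<^sup>2 \<le> V"
  proof -
    show "energy g \<le> V" "real b / t\<^sup>2 * energy g' \<le> V"
      using E by (auto simp: V_def scaled_energy_def)
    have "energy g' * 1 \<le> energy g' * b" using E b0 by (intro mult_left_mono) auto
    then have "energy g' / t\<^sup>2 \<le> energy g' * b / t\<^sup>2" by (intro divide_right_mono) auto
    also have "\<dots> \<le> V" using E by (simp add: V_def scaled_energy_def mult.commute)
    finally show "energy g' / t\<^sup>2 \<le> V" .
  qed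
  have V0: "V \<ge> 0" using V E by linarith
  \<comment> \<open>This choice makes \<open>R * \<parallel>g\<parallel>\<^sup>2\<close> and \<open>\<parallel>g'\<parallel>\<^sup>2 / R\<close> both at most \<open>R\<close> times the scaled energy.\<close>
  define R where "R = \<bar>t\<bar> / sqrt b"
  have R: "R > 0" using t0 b by (simp add: R_def)
  have sb: "sqrt b > 0" "sqrt b * sqrt b = b" using b by auto
  have tt: "\<bar>t\<bar> * \<bar>t\<bar> = t\<^sup>2" by (simp add: power2_eq_square)
  have "energy (transfer \<phi> b a t g) \<le> M / b * energy g +
    ((4 * b / \<delta> + 8 * C / \<delta>\<^sup>2 + 6 * R / \<delta>) * energy g + 6 / (\<delta> * R) * energy g') / \<bar>t\<bar>"
    by (rule energy_transfer_schur[OF \<phi> \<phi>'' g a b M \<delta> t0 R])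
  also have "\<dots> = M / b * energy g + (4 * b / \<delta> + 8 * C / \<delta>\<^sup>2) / \<bar>t\<bar> * energy g
      + 6 / (\<delta> * sqrt b) * (energy g + real b / t\<^sup>2 * energy g')"
  proof -
    have f1: "6 * R / \<delta> / \<bar>t\<bar> = 6 / (\<delta> * sqrt b)" using t0 by (simp add: R_def)
    have f2: "6 / (\<delta> * R) / \<bar>t\<bar> = 6 / (\<delta> * sqrt b) * (real b / t\<^sup>2)"
    proof -
      have "6 / (\<delta> * R) / \<bar>t\<bar> = 6 * sqrt b / (\<delta> * (\<bar>t\<bar> * \<bar>t\<bar>))" by (simp add: R_def)
      also have "\<dots> = ((6 * sqrt b) * sqrt b) / ((\<delta> * t\<^sup>2) * sqrt b)"
        unfolding tt using sb(1) by (subst nonzero_mult_divide_mult_cancel_right) auto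
      also have "\<dots> = 6 / (\<delta> * sqrt b) * (b / t\<^sup>2)"
        unfolding mult.assoc[of 6] sb(2) by simp
      finally show ?thesis .
    qed
    have f3: "((p + r) * x + s * y) / w = p / w * x + r / w * x + s / w * y" for p r s x y w :: real
      by (simp add: add_divide_distrib algebra_simps)
    show ?thesis unfolding f3 f1 f2 by (simp only: distrib_left mult.assoc add.assoc)
  qed
  also have "\<dots> \<le> M / b * V + (4 * b / \<delta> + 8 * C / \<delta>\<^sup>2) / real b ^ 2 * V + 6 / (\<delta> * sqrt b) * V"
  proof (intro add_mono mult_mono)
    show "(4 * b / \<delta> + 8 * C / \<delta>\<^sup>2) / \<bar>t\<bar> \<le> (4 * b / \<delta> + 8 * C / \<delta>\<^sup>2) / real b ^ 2"
      using t b0 \<delta> C0 by (intro divide_left_mono) (auto intro!: mult_pos_pos)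
    show "energy g + real b / t\<^sup>2 * energy g' \<le> V" by (simp add: V_def scaled_energy_def)
  qed (use M0 b0 V E V0 \<delta> C0 in \<open>auto intro!: divide_nonneg_nonneg add_nonneg_nonneg\<close>)
  finally have e1: "energy (transfer \<phi> b a t g) \<le>
    (M / b + (4 * b / \<delta> + 8 * C / \<delta>\<^sup>2) / real b ^ 2 + 6 / (\<delta> * sqrt b)) * V"
    by (simp only: distrib_right)
  have "energy (\<lambda>x. transfer \<phi> b a t h x / b) = energy (transfer \<phi> b a t h) / b\<^sup>2"
    using energy_cmult[of "1 / b" "transfer \<phi> b a t h"] by (simp add: power_inverse divide_inverse mult.commute)
  also have "\<dots> \<le> energy h / b\<^sup>2"
    by (intro divide_right_mono energy_transfer_le a b c\<phi>) (auto simp: h_def intro!: continuous_intros c\<phi> cg g)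
  also have "\<dots> \<le> (2 * energy g' + 2 * (t * C')\<^sup>2 * energy g) / b\<^sup>2"
    unfolding h_def by (intro divide_right_mono energy_phase_derivative_le c\<phi> cg g C') auto
  finally have "real b / (\<mu> * t)\<^sup>2 * energy (\<lambda>x. transfer \<phi> b a t h x / b)
      \<le> real b / (\<mu> * t)\<^sup>2 * ((2 * energy g' + 2 * (t * C')\<^sup>2 * energy g) / b\<^sup>2)"
    by (intro mult_left_mono) auto
  also have "\<dots> = 2 / (b * \<mu>\<^sup>2) * (energy g' / t\<^sup>2 + C'\<^sup>2 * energy g)"
    using b0 t0 \<open>\<mu> > 0\<close> by (simp add: field_simps power2_eq_square)
  also have "\<dots> \<le> 2 / (b * \<mu>\<^sup>2) * (V + C'\<^sup>2 * V)"
    by (intro mult_left_mono add_mono V) auto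
  finally have e2: "real b / (\<mu> * t)\<^sup>2 * energy (\<lambda>x. transfer \<phi> b a t h x / b)
      \<le> 2 * (1 + C'\<^sup>2) / (b * \<mu>\<^sup>2) * V" by (simp add: algebra_simps)
  have "scaled_energy b (\<mu> * t) (transfer \<phi> b a t g) (\<lambda>x. transfer \<phi> b a t h x / b)
     \<le> (M / b + (4 * b / \<delta> + 8 * C / \<delta>\<^sup>2) / real b ^ 2 + 6 / (\<delta> * sqrt b)) * V
       + 2 * (1 + C'\<^sup>2) / (b * \<mu>\<^sup>2) * V"
    unfolding scaled_energy_def by (rule add_mono[OF e1 e2])
  also have "\<dots> = (M / b + (4 * b / \<delta> + 8 * C / \<delta>\<^sup>2) / real b ^ 2 + 6 / (\<delta> * sqrt b)
       + 2 * (1 + C'\<^sup>2) / (b * \<mu>\<^sup>2)) * V" by (simp only: distrib_right)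
  also have "\<dots> \<le> q * V" by (rule mult_right_mono[OF q V0])
  finally show ?thesis by (simp add: V_def h_def)
qed

section \<open>Oscillatory integrals of Weierstrass functions\<close>

lemma periodic_shift_int:
  fixes \<phi> :: "real \<Rightarrow> real"
  assumes "\<And>x. \<phi> (x + 1) = \<phi> x"
  shows "\<phi> (x + of_int n) = \<phi> x"
proof -
  interpret periodic_fun_simple' \<phi> by unfold_locales (rule assms)
  show ?thesis by (rule plus_of_int)
qed

lemma periodic_continuous_bounded:
  fixes \<phi> :: "real \<Rightarrow> real"
  assumes per: "\<And>x. \<phi> (x + 1) = \<phi> x" and cont: "continuous_on UNIV \<phi>"
  shows "\<exists>C. \<forall>x. \<bar>\<phi> x\<bar> \<le> C"
proof -
  have "bounded (\<phi> ` {0..1})"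
    by (intro compact_imp_bounded compact_continuous_image continuous_on_subset[OF cont]) auto
  then obtain C where C: "\<And>x. x \<in> {0..1} \<Longrightarrow> \<bar>\<phi> x\<bar> \<le> C"
    unfolding bounded_iff by (metis imageI real_norm_def)
  have "\<bar>\<phi> x\<bar> \<le> C" for x
  proof -
    have "\<phi> x = \<phi> (frac x)"
      using periodic_shift_int[where \<phi> = \<phi> and n = "\<lfloor>x\<rfloor>" and x = "frac x", OF per] by (simp add: frac_def)
    then show ?thesis using C[of "frac x"] by (simp add: frac_ge_0 frac_lt_1 less_imp_le)
  qed
  then show ?thesis by blast
qed

context
  fixes \<phi> :: "real \<Rightarrow> real" and \<mu> :: real and b :: nat
  assumes per: "\<And>x. \<phi> (x + 1) = \<phi> x" and cont: "continuous_on UNIV \<phi>"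
    and \<mu>: "0 < \<mu>" "\<mu> < 1"
begin

lemma weierstrass_summable: "summable (\<lambda>j. \<mu> ^ j * \<phi> (real b ^ j * x))"
proof -
  obtain C where C: "\<And>x. \<bar>\<phi> x\<bar> \<le> C" using periodic_continuous_bounded[OF per cont] by blast
  show ?thesis
  proof (rule summable_comparison_test')
    show "summable (\<lambda>j. \<mu> ^ j * C)" using \<mu> by (intro summable_mult2 summable_geometric) auto
    show "norm (\<mu> ^ j * \<phi> (real b ^ j * x)) \<le> \<mu> ^ j * C" if "j \<ge> 0" for j
      using \<mu> C by (auto simp: abs_mult intro!: mult_left_mono)
  qed
qed

lemma weierstrass_continuous: "continuous_on UNIV (weierstrass \<phi> \<mu> b)"
proof -
  obtain C where C: "\<And>x. \<bar>\<phi> x\<bar> \<le> C" using periodic_continuous_bounded[OF per cont] by blast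
  have "uniform_limit UNIV (\<lambda>n x. \<Sum>j<n. \<mu> ^ j * \<phi> (real b ^ j * x)) (weierstrass \<phi> \<mu> b) sequentially"
    unfolding weierstrass_def[abs_def]
  proof (rule Weierstrass_m_test)
    show "summable (\<lambda>j. \<mu> ^ j * C)" using \<mu> by (intro summable_mult2 summable_geometric) auto
    show "norm (\<mu> ^ j * \<phi> (real b ^ j * x)) \<le> \<mu> ^ j * C" for j x
      using \<mu> C by (auto simp: abs_mult intro!: mult_left_mono)
  qed
  then show ?thesis
    by (rule uniform_limit_theorem[rotated])
      (auto intro!: always_eventually continuous_intros continuous_on_compose2[OF cont])
qed

lemma weierstrass_periodic: "weierstrass \<phi> \<mu> b (x + real n) = weierstrass \<phi> \<mu> b x"
proof -
  have "\<phi> (real b ^ j * (x + real n)) = \<phi> (real b ^ j * x)" for j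
    using periodic_shift_int[where \<phi> = \<phi> and n = "int (b ^ j * n)" and x = "real b ^ j * x", OF per]
    by (simp add: distrib_left)
  then show ?thesis by (simp add: weierstrass_def)
qed

lemma weierstrass_self_similar: "weierstrass \<phi> \<mu> b x = \<phi> x + \<mu> * weierstrass \<phi> \<mu> b (real b * x)"
proof -
  have "weierstrass \<phi> \<mu> b x = \<phi> x + (\<Sum>j. \<mu> ^ Suc j * \<phi> (real b ^ Suc j * x))"
    unfolding weierstrass_def using suminf_split_head[OF weierstrass_summable, of x] by simp
  also have "(\<Sum>j. \<mu> ^ Suc j * \<phi> (real b ^ Suc j * x)) = (\<Sum>j. \<mu> * (\<mu> ^ j * \<phi> (real b ^ j * (real b * x))))"
    by (simp add: mult_ac)
  also have "\<dots> = \<mu> * weierstrass \<phi> \<mu> b (real b * x)"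
    unfolding weierstrass_def by (rule suminf_mult[OF weierstrass_summable])
  finally show ?thesis .
qed

text \<open>On the branch \<open>\<theta> = (x + j) / b\<close> the exponential \<open>e(\<nu> \<theta>)\<close> splits into the constant
\<open>e(\<nu> j / b)\<close>, which becomes a weight, and \<open>e(\<nu> x / b)\<close>, which is common to all branches. By
self-similarity and periodicity \<open>W\<close> splits into \<open>\<phi>(\<theta>)\<close> and \<open>\<mu> W(x)\<close>.\<close>

lemma oscillatory_integral_transfer:
  assumes cg: "continuous_on UNIV g" and b: "b \<ge> 1"
  shows "integral {0..1} (\<lambda>x. cis (\<nu> * x) * g x * cis (t * weierstrass \<phi> \<mu> b x)) =
    integral {0..1} (\<lambda>x. cis (\<nu> / b * x) * transfer \<phi> b (\<lambda>j. cis (\<nu> * j / b)) t g x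
       * cis (\<mu> * t * weierstrass \<phi> \<mu> b x))"
proof -
  let ?W = "weierstrass \<phi> \<mu> b"
  let ?F = "\<lambda>x. cis (\<nu> * x) * g x * cis (t * ?W x)"
  have cF: "continuous_on UNIV ?F" by (intro continuous_intros cg weierstrass_continuous)
  have branch: "?F ((x + real j) / b) = cis (\<nu> / b * x) * (cis (\<nu> * j / b) * g ((x + real j) / b)
      * cis (t * \<phi> ((x + real j) / b))) * cis (\<mu> * t * ?W x)" for x j
  proof -
    have "real b * ((x + real j) / b) = x + real j" using b by simp
    then have "?W ((x + real j) / b) = \<phi> ((x + real j) / b) + \<mu> * ?W x"
      using weierstrass_self_similar[of "(x + real j) / b"] weierstrass_periodic[of x j] by metis
    then have "cis (t * ?W ((x + real j) / b)) = cis (t * \<phi> ((x + real j) / b)) * cis (\<mu> * t * ?W x)"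
      by (simp add: cis_mult algebra_simps)
    moreover have "cis (\<nu> * ((x + real j) / b)) = cis (\<nu> / b * x) * cis (\<nu> * j / b)"
      by (simp add: cis_mult add_divide_distrib algebra_simps)
    ultimately show ?thesis by (simp only: mult_ac)
  qed
  have "integral {0..1} ?F = (\<Sum>j<b. integral {0..1} (\<lambda>x. ?F ((x + real j) / b))) /\<^sub>R b"
    by (rule integral_branches[OF continuous_on_subset[OF cF] b]) auto
  also have "(\<Sum>j<b. integral {0..1} (\<lambda>x. ?F ((x + real j) / b)))
      = integral {0..1} (\<lambda>x. \<Sum>j<b. ?F ((x + real j) / b))"
    by (intro Henstock_Kurzweil_Integration.integral_sum[symmetric] integrable_continuous_interval
        continuous_on_branch cF finite_lessThan)
  also have "\<dots> /\<^sub>R b = integral {0..1} (\<lambda>x. (\<Sum>j<b. ?F ((x + real j) / b)) /\<^sub>R b)"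
    by simp
  also have "\<dots> = integral {0..1} (\<lambda>x. cis (\<nu> / b * x) * transfer \<phi> b (\<lambda>j. cis (\<nu> * j / b)) t g x
       * cis (\<mu> * t * ?W x))"
    unfolding branch transfer_def
    by (simp add: scaleR_conv_of_real sum_distrib_left sum_distrib_right divide_inverse mult_ac)
  finally show ?thesis .
qed

lemma oscillatory_integral_le_energy:
  assumes cg: "continuous_on UNIV g"
  shows "(norm (integral {0..1} (\<lambda>x. cis (\<nu> * x) * g x * cis (t * weierstrass \<phi> \<mu> b x))))\<^sup>2 \<le> energy g"
proof -
  define m where "m = integral {0..1} (\<lambda>x. norm (g x))"
  have c: "continuous_on {0..1} g" by (rule continuous_on_subset[OF cg]) simp
  have cW: "continuous_on {0..1} (weierstrass \<phi> \<mu> b)"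
    by (rule continuous_on_subset[OF weierstrass_continuous]) simp
  have "norm (integral {0..1} (\<lambda>x. cis (\<nu> * x) * g x * cis (t * weierstrass \<phi> \<mu> b x))) \<le> m"
    unfolding m_def
    by (intro Henstock_Kurzweil_Integration.integral_norm_bound_integral integrable_continuous_interval
        continuous_intros c cW) (auto simp: norm_mult)
  then have "(norm (integral {0..1} (\<lambda>x. cis (\<nu> * x) * g x * cis (t * weierstrass \<phi> \<mu> b x))))\<^sup>2 \<le> m\<^sup>2"
    by (intro power_mono) auto
  moreover have "0 \<le> integral {0..1} (\<lambda>x. (norm (g x) - m)\<^sup>2)"
    by (intro Henstock_Kurzweil_Integration.integral_nonneg integrable_continuous_interval
        continuous_intros c) auto
  moreover have "integral {0..1} (\<lambda>x. (norm (g x) - m)\<^sup>2) = energy g - m\<^sup>2"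
  proof -
    have "((\<lambda>x. (norm (g x))\<^sup>2) has_integral energy g) {0..1}"
      unfolding energy_def by (intro integrable_integral energy_integrable cg)
    moreover have "((\<lambda>x. norm (g x)) has_integral m) {0..1}"
      unfolding m_def by (intro integrable_integral integrable_continuous_interval continuous_intros c)
    moreover have "((\<lambda>x::real. m\<^sup>2) has_integral m\<^sup>2) {0..1}"
      using has_integral_const_real[of "m\<^sup>2" 0 1] by simp
    ultimately have "((\<lambda>x. (norm (g x))\<^sup>2 - 2 * m * norm (g x) + m\<^sup>2) has_integral
        energy g - 2 * m * m + m\<^sup>2) {0..1}"
      by (intro has_integral_add has_integral_diff has_integral_mult_right)
    then show ?thesis
      by (simp add: integral_unique power2_diff power2_eq_square algebra_simps)
  qed
  ultimately show ?thesis by linarith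
qed

text \<open>The contraction is available as long as the current parameter is at least \<open>b\<^sup>2\<close>; the last
hypothesis guarantees this for \<open>N\<close> steps.\<close>

lemma oscillatory_integral_iterate:
  fixes \<phi>' :: "real \<Rightarrow> real" and q :: real
  assumes \<phi>': "\<And>x. (\<phi> has_real_derivative \<phi>' x) (at x)" "continuous_on UNIV \<phi>'"
    and b: "b \<ge> 1" and q: "q \<ge> 0"
    and contr: "\<And>a t g g'. \<lbrakk>\<And>x. (g has_vector_derivative g' x) (at x); continuous_on UNIV g';
       \<And>j. norm (a j :: complex) \<le> 1; \<bar>t\<bar> \<ge> real b ^ 2\<rbrakk> \<Longrightarrow>
       scaled_energy b (\<mu> * t) (transfer \<phi> b a t g)
         (\<lambda>x. transfer \<phi> b a t (\<lambda>u. g' u + \<i> * of_real (t * \<phi>' u) * g u) x / b)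
       \<le> q * scaled_energy b t g g'"
    and "\<And>x. (g has_vector_derivative g' x) (at x)" "continuous_on UNIV g'"
    and "real b ^ 2 \<le> \<bar>t\<bar> * \<mu> ^ N"
  shows "(norm (integral {0..1} (\<lambda>x. cis (\<nu> * x) * g x * cis (t * weierstrass \<phi> \<mu> b x))))\<^sup>2
     \<le> q ^ N * scaled_energy b t g g'"
  using assms(6-)
proof (induction N arbitrary: \<nu> t g g')
  case 0
  have "continuous_on UNIV g"
    using 0(1) by (intro continuous_at_imp_continuous_on) (auto intro: has_vector_derivative_continuous)
  then have "(norm (integral {0..1} (\<lambda>x. cis (\<nu> * x) * g x * cis (t * weierstrass \<phi> \<mu> b x))))\<^sup>2 \<le> energy g"
    by (rule oscillatory_integral_le_energy)
  also have "\<dots> \<le> q ^ 0 * scaled_energy b t g g'"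
    using energy_nonneg[of g'] by (simp add: scaled_energy_def)
  finally show ?case .
next
  case (Suc N)
  have cg: "continuous_on UNIV g"
    using Suc.prems(1) by (intro continuous_at_imp_continuous_on) (auto intro: has_vector_derivative_continuous)
  let ?a = "\<lambda>j. cis (\<nu> * real j / b)"
  let ?T = "transfer \<phi> b ?a t g"
  let ?T' = "\<lambda>x. transfer \<phi> b ?a t (\<lambda>u. g' u + \<i> * of_real (t * \<phi>' u) * g u) x / b"
  have "\<mu> ^ Suc N \<le> 1" using \<mu> by (intro power_le_one) auto
  then have "\<bar>t\<bar> * \<mu> ^ Suc N \<le> \<bar>t\<bar> * 1" by (intro mult_left_mono) auto
  then have t: "\<bar>t\<bar> \<ge> real b ^ 2" using Suc.prems(3) by linarith
  have "(norm (integral {0..1} (\<lambda>x. cis (\<nu> * x) * g x * cis (t * weierstrass \<phi> \<mu> b x))))\<^sup>2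
    = (norm (integral {0..1} (\<lambda>x. cis (\<nu> / b * x) * ?T x * cis ((\<mu> * t) * weierstrass \<phi> \<mu> b x))))\<^sup>2"
    by (subst oscillatory_integral_transfer[OF cg b]) simp
  also have "\<dots> \<le> q ^ N * scaled_energy b (\<mu> * t) ?T ?T'"
  proof (rule Suc.IH)
    show "(?T has_vector_derivative ?T' x) (at x)" for x
      by (rule transfer_has_vector_derivative[OF \<phi>'(1) Suc.prems(1)])
    show "continuous_on UNIV ?T'"
      unfolding divide_inverse
      by (intro continuous_on_mult continuous_on_const continuous_on_transfer cont)
        (intro continuous_intros cg Suc.prems(2) \<phi>'(2))
    show "real b ^ 2 \<le> \<bar>\<mu> * t\<bar> * \<mu> ^ N" using Suc.prems(3) \<mu> by (simp add: abs_mult mult_ac)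
  qed
  also have "\<dots> \<le> q ^ N * (q * scaled_energy b t g g')"
    using q by (intro mult_left_mono contr Suc.prems t) auto
  finally show ?case by (simp add: mult_ac)
qed

end

text \<open>The rate of the contraction for \<open>\<delta> = b powr (-1/4)\<close> and the grid count as \<open>M\<close>. Its terms are of
orders \<open>-\<gamma>/4\<close>, \<open>-1\<close>, \<open>-3/4\<close>, \<open>-3/2\<close> and \<open>-1/4\<close> in \<open>b\<close>, all below \<open>-\<gamma>/8\<close> because \<open>\<gamma> \<le> 1\<close>.\<close>

lemma contraction_constants_eventually:
  fixes K \<gamma> C C' \<mu> :: real
  assumes "\<gamma> > 0" "\<gamma> \<le> 1" "\<mu> > 0"
  shows "eventually (\<lambda>b::real. K * (b * (b powr (-1/4)) powr \<gamma> + 1) / b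
     + (4 * b / b powr (-1/4) + 8 * C / (b powr (-1/4))\<^sup>2) / b ^ 2 + 6 / (b powr (-1/4) * sqrt b)
     + 2 * (1 + C'\<^sup>2) / (b * \<mu>\<^sup>2) \<le> b powr (-\<gamma>/8)) at_top"
    (is "eventually (\<lambda>b. ?f b \<le> _) _")
proof -
  let ?h = "\<lambda>b. K * (b powr (-\<gamma>/4) + b powr (-1)) +
    (4 * b powr (-3/4) + 8 * C * b powr (-3/2) + 6 * b powr (-1/4) + 2 * (1 + C'\<^sup>2) / \<mu>\<^sup>2 * b powr (-1))"
  have 1: "((\<lambda>b::real. K * (b powr (-\<gamma>/8) + b powr (-1 + \<gamma>/8))) \<longlongrightarrow> 0) at_top"
    using assms by real_asymp
  have 2: "((\<lambda>b::real. 4 * b powr (-3/4 + \<gamma>/8) + 8 * C * b powr (-3/2 + \<gamma>/8)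
     + 6 * b powr (-1/4 + \<gamma>/8) + 2 * (1 + C'\<^sup>2) / \<mu>\<^sup>2 * b powr (-1 + \<gamma>/8)) \<longlongrightarrow> 0) at_top"
    using assms by real_asymp
  have 3: "eventually (\<lambda>b::real. K * (b powr (-\<gamma>/8) + b powr (-1 + \<gamma>/8)) +
     (4 * b powr (-3/4 + \<gamma>/8) + 8 * C * b powr (-3/2 + \<gamma>/8)
     + 6 * b powr (-1/4 + \<gamma>/8) + 2 * (1 + C'\<^sup>2) / \<mu>\<^sup>2 * b powr (-1 + \<gamma>/8)) < 1) at_top"
    using order_tendstoD(2)[OF tendsto_add[OF 1 2], of 1] by simp
  show ?thesis
    using 3 eventually_gt_at_top[of 0]
  proof eventually_elim
    case (elim b)
    define y where "y = ln b"
    have b: "b = exp y" using elim(2) by (simp add: y_def)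
    have p: "b powr a = exp (a * y)" for a by (simp add: b powr_def)
    have d: "u / exp v = u * exp (- v)" for u v :: real by (simp add: exp_minus divide_inverse)
    have "?f b = ?h b"
    proof -
      have e1: "(b powr (-1/4)) powr \<gamma> = b powr (-\<gamma>/4)" by (simp add: powr_powr)
      have e2: "4 * b / b powr (-1/4) / b ^ 2 = 4 * b powr (-3/4)"
        unfolding p unfolding b exp_of_nat_mult[symmetric] d
        by (simp add: mult_exp_exp mult.assoc)
      have e3: "8 * C / (b powr (-1/4))\<^sup>2 / b ^ 2 = 8 * C * b powr (-3/2)"
        unfolding p unfolding b exp_of_nat_mult[symmetric] d
        by (simp add: mult_exp_exp mult.assoc)
      have e4: "6 / (b powr (-1/4) * sqrt b) = 6 * b powr (-1/4)"
        unfolding powr_half_sqrt[OF less_imp_le[OF elim(2)], symmetric] p mult_exp_exp d by simp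
      have e5: "1 / b = b powr (-1)" using elim(2) by (simp add: powr_minus_divide)
      have "?f b = K * ((b powr (-1/4)) powr \<gamma> + 1 / b) + (4 * b / b powr (-1/4) / b ^ 2
          + 8 * C / (b powr (-1/4))\<^sup>2 / b ^ 2 + 6 / (b powr (-1/4) * sqrt b)
          + 2 * (1 + C'\<^sup>2) / \<mu>\<^sup>2 * (1 / b))"
        using elim(2) by (simp add: add_divide_distrib distrib_left mult.commute[of b])
      then show ?thesis unfolding e1 e2 e3 e4 e5 .
    qed
    also have "?h b = (K * (b powr (-\<gamma>/8) + b powr (-1 + \<gamma>/8)) +
     (4 * b powr (-3/4 + \<gamma>/8) + 8 * C * b powr (-3/2 + \<gamma>/8)
     + 6 * b powr (-1/4 + \<gamma>/8) + 2 * (1 + C'\<^sup>2) / \<mu>\<^sup>2 * b powr (-1 + \<gamma>/8))) * b powr (-\<gamma>/8)"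
      by (simp only: distrib_left distrib_right mult.assoc powr_add[symmetric]) simp
    also have "\<dots> \<le> 1 * b powr (-\<gamma>/8)"
      using elim(1) by (intro mult_right_mono) auto
    finally show ?case by simp
  qed
qed

text \<open>Each step gains \<open>b powr (-\<gamma>/8)\<close> in energy, hence \<open>b powr (-\<gamma>/16)\<close> in norm, and there are
\<open>ln (\<bar>t\<bar> / b\<^sup>2) / \<bar>ln \<mu>\<bar>\<close> steps up to rounding. The constant \<open>A\<close> pays for the rounding and for the
part of the range below \<open>b\<^sup>2\<close>.\<close>

lemma weierstrass_oscillatory_decay:
  fixes \<phi> :: "real \<Rightarrow> real"
  assumes an: "real_analytic \<phi>" and per: "\<And>x. \<phi> (x + 1) = \<phi> x" and nc: "\<not> \<phi> constant_on UNIV"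
  shows "\<exists>c>0. \<forall>\<mu>. 0 < \<mu> \<and> \<mu> < 1 \<longrightarrow> (\<exists>b\<^sub>0\<ge>2. \<forall>b::nat. real b \<ge> b\<^sub>0 \<longrightarrow>
    (\<exists>A. \<forall>\<nu> t. \<bar>t\<bar> \<ge> real b ^ 2 \<longrightarrow>
      norm (integral {0..1} (\<lambda>x. cis (\<nu> * x) * cis (t * weierstrass \<phi> \<mu> b x)))
        \<le> A * \<bar>t\<bar> powr (- c * (ln (real b) / \<bar>ln \<mu>\<bar>))))"
proof -
  define \<phi>' where "\<phi>' = deriv \<phi>"
  define \<phi>'' where "\<phi>'' = deriv \<phi>'"
  have an': "real_analytic \<phi>'" "real_analytic \<phi>''"
    unfolding \<phi>'_def \<phi>''_def by (intro real_analytic_derivative(2) an)+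
  have d: "(\<phi> has_real_derivative \<phi>' x) (at x)" "(\<phi>' has_real_derivative \<phi>'' x) (at x)"
    "(\<phi>'' has_real_derivative deriv \<phi>'' x) (at x)" for x
    using real_analytic_derivative(1)[OF an] real_analytic_derivative(1)[OF an'(1)]
      real_analytic_derivative(1)[OF an'(2)] by (simp_all add: \<phi>'_def \<phi>''_def)
  have cont: "continuous_on UNIV \<phi>" "continuous_on UNIV \<phi>'" "continuous_on UNIV \<phi>''"
    using d by (auto intro!: continuous_at_imp_continuous_on DERIV_isCont)
  have bd: "\<exists>B. \<forall>x\<in>{0..1}. \<bar>f x\<bar> \<le> B" if "continuous_on UNIV f" for f :: "real \<Rightarrow> real"
  proof -
    have "bounded (f ` {0..1})"
      by (intro compact_imp_bounded compact_continuous_image continuous_on_subset[OF that]) auto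
    then show ?thesis by (simp add: bounded_iff)
  qed
  obtain C' where C': "\<And>x. x \<in> {0..1} \<Longrightarrow> \<bar>\<phi>' x\<bar> \<le> C'" using bd[OF cont(2)] by blast
  obtain C where C: "\<And>x. x \<in> {0..1} \<Longrightarrow> \<bar>\<phi>'' x\<bar> \<le> C" using bd[OF cont(3)] by blast
  obtain y z where "\<phi>' y \<noteq> \<phi>' z"
    using periodic_nonconstant_derivative_nonconstant[OF an per nc] by (auto simp: \<phi>'_def)
  from analytic_sublevel_grid_count[OF an'(1) this]
  obtain K \<gamma> where K: "K > 0" and \<gamma>: "\<gamma> > 0" "\<gamma> \<le> 1"
    and count: "\<And>b y \<delta>. b \<ge> (1::nat) \<Longrightarrow> 0 < \<delta> \<Longrightarrow> \<delta> \<le> 1 \<Longrightarrow>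
      real (card {k::nat. k \<le> b \<and> \<bar>\<phi>' (k / b) - y\<bar> \<le> \<delta>}) \<le> K * (b * \<delta> powr \<gamma> + 1)"
    by blast
  have main: "\<exists>b\<^sub>0\<ge>2. \<forall>b::nat. real b \<ge> b\<^sub>0 \<longrightarrow>
    (\<exists>A. \<forall>\<nu> t. \<bar>t\<bar> \<ge> real b ^ 2 \<longrightarrow>
      norm (integral {0..1} (\<lambda>x. cis (\<nu> * x) * cis (t * weierstrass \<phi> \<mu> b x)))
        \<le> A * \<bar>t\<bar> powr (- (\<gamma> / 16) * (ln (real b) / \<bar>ln \<mu>\<bar>)))" if \<mu>: "0 < \<mu>" "\<mu> < 1" for \<mu>
  proof -
    have "eventually (\<lambda>b::real. 4 * C / b \<le> b powr (-1/4)) at_top" by real_asymp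
    from eventually_conj[OF contraction_constants_eventually[OF \<gamma> \<mu>(1), of K C C'] this]
    obtain b1 where b1: "\<And>b. b \<ge> b1 \<Longrightarrow> K * (b * (b powr (-1/4)) powr \<gamma> + 1) / b
     + (4 * b / b powr (-1/4) + 8 * C / (b powr (-1/4))\<^sup>2) / b ^ 2 + 6 / (b powr (-1/4) * sqrt b)
     + 2 * (1 + C'\<^sup>2) / (b * \<mu>\<^sup>2) \<le> b powr (-\<gamma>/8)"
      "\<And>b. b \<ge> b1 \<Longrightarrow> 4 * C / b \<le> b powr (-1/4)"
      unfolding eventually_at_top_linorder by blast
    have "\<exists>A. \<forall>\<nu> t. \<bar>t\<bar> \<ge> real b ^ 2 \<longrightarrow>
      norm (integral {0..1} (\<lambda>x. cis (\<nu> * x) * cis (t * weierstrass \<phi> \<mu> b x)))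
        \<le> A * \<bar>t\<bar> powr (- (\<gamma> / 16) * (ln (real b) / \<bar>ln \<mu>\<bar>))" if b: "real b \<ge> max 2 b1" for b :: nat
    proof -
      define \<delta> where "\<delta> = real b powr (-1/4)"
      define q where "q = real b powr (-\<gamma>/8)"
      have b1': "b \<ge> 1" "real b \<ge> 2" using b by auto
      have \<delta>: "\<delta> > 0" "\<delta> \<le> 1" "4 * C / b \<le> \<delta>"
        using b1(2)[of "real b"] b b1' powr_mono[of "-1/4" 0 "real b"] by (auto simp: \<delta>_def)
      have contr: "scaled_energy b (\<mu> * t) (transfer \<phi> b a t g)
         (\<lambda>x. transfer \<phi> b a t (\<lambda>u. g' u + \<i> * of_real (t * \<phi>' u) * g u) x / b)
       \<le> q * scaled_energy b t g g'"
        if "\<And>x. (g has_vector_derivative g' x) (at x)" "continuous_on UNIV g'"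
          "\<And>j. norm (a j :: complex) \<le> 1" "\<bar>t\<bar> \<ge> real b ^ 2" for a t g g'
      proof (rule transfer_contraction[where M = "K * (b * \<delta> powr \<gamma> + 1)", OF d(1,2) cont(3) C C' that(1,2,3) b1'(1) _ \<delta>(1,3) that(4) \<mu>(1)])
        fix j assume "j < b"
        have "card {k. k < b \<and> \<bar>\<phi>' (j / b) - \<phi>' (k / b)\<bar> \<le> \<delta>} \<le> card {k. k \<le> b \<and> \<bar>\<phi>' (k / b) - \<phi>' (j / b)\<bar> \<le> \<delta>}"
          by (intro card_mono) (auto simp: abs_minus_commute)
        then show "real (card {k. k < b \<and> \<bar>\<phi>' (j / b) - \<phi>' (k / b)\<bar> \<le> \<delta>}) \<le> K * (b * \<delta> powr \<gamma> + 1)"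
          using count[OF b1'(1) \<delta>(1,2), of "\<phi>' (j / b)"] by linarith
      next
        show "K * (b * \<delta> powr \<gamma> + 1) / b + (4 * b / \<delta> + 8 * C / \<delta>\<^sup>2) / real b ^ 2 + 6 / (\<delta> * sqrt b)
          + 2 * (1 + C'\<^sup>2) / (b * \<mu>\<^sup>2) \<le> q"
          unfolding \<delta>_def q_def using b b1(1)[of "real b"] by simp
      qed
      define L where "L = \<bar>ln \<mu>\<bar>"
      have L: "L > 0" "ln \<mu> = - L" using \<mu> by (auto simp: L_def)
      define e where "e = \<gamma> / 16 * (ln b / L)"
      define A where "A = exp (\<gamma> / 16 * ln b) * (real b ^ 2) powr e"
      have "norm (integral {0..1} (\<lambda>x. cis (\<nu> * x) * cis (t * weierstrass \<phi> \<mu> b x)))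
        \<le> A * \<bar>t\<bar> powr (- (\<gamma> / 16) * (ln (real b) / \<bar>ln \<mu>\<bar>))" if t: "\<bar>t\<bar> \<ge> real b ^ 2" for \<nu> t
      proof -
        have tp: "\<bar>t\<bar> > 0" using t b1' by (smt (verit) zero_less_power)
        define l where "l = ln (\<bar>t\<bar> / real b ^ 2) / L"
        have l0: "l \<ge> 0" unfolding l_def using t b1' L by (intro divide_nonneg_nonneg ln_ge_zero) auto
        define N where "N = nat \<lfloor>l\<rfloor>"
        have N: "real N \<le> l" "l - 1 \<le> real N" using l0 by (auto simp: N_def)
        have "ln (real b ^ 2) \<le> ln (\<bar>t\<bar> * \<mu> ^ N)"
        proof -
          have "real N * L \<le> ln (\<bar>t\<bar> / real b ^ 2)"
            using N(1) L(1) by (simp add: l_def pos_le_divide_eq)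
          also have "\<dots> = ln \<bar>t\<bar> - ln (real b ^ 2)" using tp b1' by (simp add: ln_div)
          finally have "ln (real b ^ 2) \<le> ln \<bar>t\<bar> + real N * ln \<mu>" by (simp add: L(2))
          then show ?thesis using tp \<mu> by (simp add: ln_mult ln_realpow)
        qed
        then have tN: "real b ^ 2 \<le> \<bar>t\<bar> * \<mu> ^ N" using tp \<mu> b1' by simp
        have "(norm (integral {0..1} (\<lambda>x. cis (\<nu> * x) * 1 * cis (t * weierstrass \<phi> \<mu> b x))))\<^sup>2
          \<le> q ^ N * scaled_energy b t (\<lambda>_. 1) (\<lambda>_. 0)"
          by (rule oscillatory_integral_iterate[OF per cont(1) \<mu> d(1) cont(2) b1'(1) _ contr _ _ tN])
            (auto simp: q_def)
        also have "\<dots> = q ^ N" by (simp add: scaled_energy_def energy_def)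
        also have "\<dots> = exp (- (\<gamma> / 8) * ln b * real N)"
          using b1' by (simp add: q_def powr_def exp_of_nat_mult[symmetric] mult_ac)
        also have "\<dots> \<le> exp (- (\<gamma> / 8) * ln b * (l - 1))"
          using N(2) \<gamma> b1' by (simp add: mult_left_mono)
        also have "\<dots> = (exp (- (\<gamma> / 16) * ln b * (l - 1)))\<^sup>2"
          by (simp add: exp_of_nat_mult[symmetric] power2_eq_square mult_exp_exp)
        finally have "norm (integral {0..1} (\<lambda>x. cis (\<nu> * x) * 1 * cis (t * weierstrass \<phi> \<mu> b x)))
            \<le> exp (- (\<gamma> / 16) * ln b * (l - 1))"
          by (rule power2_le_imp_le) simp
        also have "\<dots> = exp (\<gamma> / 16 * ln b) * exp (- (e * ln (\<bar>t\<bar> / real b ^ 2)))"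
          using L(1) by (simp add: l_def e_def mult_exp_exp algebra_simps)
        also have "\<dots> = A * \<bar>t\<bar> powr (- e)"
          using tp b1' by (simp add: A_def powr_def ln_div mult_exp_exp algebra_simps)
        finally show ?thesis by (simp add: e_def L_def)
      qed
      then show ?thesis by blast
    qed
    then show ?thesis by (intro exI[of _ "max 2 b1"]) auto
  qed
  show ?thesis
    by (rule exI[of _ "\<gamma> / 16"]) (use \<gamma> main in auto)
qed

section \<open>Densities by Fourier inversion\<close>

lemma DERIV_under_integral:
  fixes f f' :: "real \<Rightarrow> 'a \<Rightarrow> real"
  assumes meas: "\<And>x. f x \<in> borel_measurable M" "\<And>x. f' x \<in> borel_measurable M"
    and deriv: "\<And>x t. ((\<lambda>x. f x t) has_real_derivative f' x t) (at x)"
    and bound: "\<And>x t. \<bar>f' x t\<bar> \<le> G t" "integrable M G" and base: "integrable M (f x0)"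
  shows "integrable M (f x)" and "((\<lambda>x. \<integral>t. f x t \<partial>M) has_real_derivative (\<integral>t. f' x t \<partial>M)) (at x)"
proof -
  have lip: "\<bar>f y t - f z t\<bar> \<le> G t * \<bar>y - z\<bar>" for y z t
    using field_differentiable_bound[of UNIV "\<lambda>x. f x t" "\<lambda>x. f' x t" "G t" y z] deriv bound(1) by simp
  have int: "integrable M (f y)" for y
  proof -
    have "integrable M (\<lambda>t. f y t - f x0 t)"
    proof (rule Bochner_Integration.integrable_bound)
      show "integrable M (\<lambda>t. G t * \<bar>y - x0\<bar>)" using bound(2) by simp
      show "AE t in M. norm (f y t - f x0 t) \<le> norm (G t * \<bar>y - x0\<bar>)"
        using lip by (intro AE_I2) (metis abs_ge_self order_trans real_norm_def)
    qed (use meas in measurable)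
    from Bochner_Integration.integrable_add[OF this base] show ?thesis by simp
  qed
  show "integrable M (f x)" by (rule int)
  show "((\<lambda>x. \<integral>t. f x t \<partial>M) has_real_derivative (\<integral>t. f' x t \<partial>M)) (at x)"
    unfolding has_field_derivative_iff tendsto_at_iff_sequentially
  proof (intro allI impI)
    fix X assume X: "\<forall>i. X i \<in> UNIV - {x}" "X \<longlonglongrightarrow> x"
    have "(\<lambda>i. \<integral>t. (f (X i) t - f x t) / (X i - x) \<partial>M) \<longlonglongrightarrow> (\<integral>t. f' x t \<partial>M)"
    proof (rule integral_dominated_convergence)
      show "AE t in M. (\<lambda>i. (f (X i) t - f x t) / (X i - x)) \<longlonglongrightarrow> f' x t"
      proof (intro AE_I2)
        fix t
        have "((\<lambda>y. (f y t - f x t) / (y - x)) \<longlongrightarrow> f' x t) (at x)"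
          using deriv[of t x] unfolding has_field_derivative_iff .
        then show "(\<lambda>i. (f (X i) t - f x t) / (X i - x)) \<longlonglongrightarrow> f' x t"
          unfolding tendsto_at_iff_sequentially using X by (auto simp: o_def)
      qed
      show "AE t in M. norm ((f (X i) t - f x t) / (X i - x)) \<le> G t" for i
        using X(1) lip[of "X i" _ x] by (intro AE_I2) (auto simp: pos_divide_le_eq)
    qed (use meas bound(2) in measurable)
    moreover have "(\<integral>t. (f (X i) t - f x t) / (X i - x) \<partial>M)
        = ((\<integral>t. f (X i) t \<partial>M) - (\<integral>t. f x t \<partial>M)) / (X i - x)" for i
      by (simp add: int)
    ultimately show "((\<lambda>y. ((\<integral>t. f y t \<partial>M) - (\<integral>t. f x t \<partial>M)) / (y - x)) \<circ> X)
        \<longlonglongrightarrow> (\<integral>t. f' x t \<partial>M)"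
      unfolding o_def by (simp only:)
  qed
qed

lemma continuous_on_parametric_integral:
  fixes f :: "real \<Rightarrow> 'a \<Rightarrow> real"
  assumes "\<And>x. f x \<in> borel_measurable M" "\<And>t. continuous_on UNIV (\<lambda>x. f x t)"
    "\<And>x t. \<bar>f x t\<bar> \<le> G t" "integrable M G"
  shows "continuous_on UNIV (\<lambda>x. \<integral>t. f x t \<partial>M)"
  unfolding continuous_on_sequentially comp_def
proof (intro ballI allI impI)
  fix x :: real and X :: "nat \<Rightarrow> real" assume X: "(\<forall>n. X n \<in> UNIV) \<and> X \<longlonglongrightarrow> x"
  show "(\<lambda>n. \<integral>t. f (X n) t \<partial>M) \<longlonglongrightarrow> (\<integral>t. f x t \<partial>M)"
  proof (rule integral_dominated_convergence[where w = G])
    show "AE t in M. (\<lambda>n. f (X n) t) \<longlonglongrightarrow> f x t"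
      using assms(2) X unfolding continuous_on_sequentially comp_def by (intro AE_I2) auto
  qed (use assms in auto)
qed

text \<open>In the following context the density of \<open>M\<close> is recovered as \<open>inversion_integral 0\<close>, the real part
of the inverse Fourier transform of the characteristic function; \<open>inversion_integral j\<close> is its
\<open>j\<close>-th derivative, obtained by differentiating under the integral.\<close>

context real_distribution
begin

definition inversion_integrand :: "nat \<Rightarrow> real \<Rightarrow> real \<Rightarrow> real" where
  "inversion_integrand j x t = Re ((- \<i> * of_real t) ^ j * cis (- (t * x)) * char M t) / (2 * pi)"

definition inversion_integral :: "nat \<Rightarrow> real \<Rightarrow> real" where
  "inversion_integral j x = (\<integral>t. inversion_integrand j x t \<partial>lborel)"

lemma inversion_integrand_measurable [measurable]: "inversion_integrand j x \<in> borel_measurable borel"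
proof -
  have "continuous_on UNIV (char M)"
    by (intro continuous_at_imp_continuous_on ballI isCont_char)
  then have "continuous_on UNIV (inversion_integrand j x)"
    unfolding inversion_integrand_def[abs_def] by (intro continuous_intros) auto
  then show ?thesis by (rule borel_measurable_continuous_onI)
qed

lemma inversion_integrand_bound:
  "\<bar>inversion_integrand j x t\<bar> \<le> \<bar>t\<bar> ^ j * norm (char M t)"
proof -
  have "\<bar>Re ((- \<i> * of_real t) ^ j * cis (- (t * x)) * char M t)\<bar> \<le> \<bar>t\<bar> ^ j * norm (char M t)"
    by (rule order_trans[OF abs_Re_le_cmod]) (simp add: norm_mult norm_power)
  moreover have "\<bar>t\<bar> ^ j * norm (char M t) * 1 \<le> \<bar>t\<bar> ^ j * norm (char M t) * (2 * pi)"
    using pi_ge_two by (intro mult_left_mono) auto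
  ultimately show ?thesis
    unfolding inversion_integrand_def abs_divide using pi_gt_zero by (simp add: pos_divide_le_eq)
qed

lemma cis_neg_mult_has_vector_derivative:
  "((\<lambda>x. cis (- (t * x))) has_vector_derivative (- \<i> * of_real t) * cis (- (t * x))) (at x)"
proof -
  have "((\<lambda>x. - (t * x)) has_real_derivative - t) (at x)" by (auto intro!: derivative_eq_intros)
  from has_vector_derivative_cis[OF this] show ?thesis by (simp add: mult_ac)
qed

lemma inversion_integrand_deriv:
  "((\<lambda>x. inversion_integrand j x t) has_real_derivative inversion_integrand (Suc j) x t) (at x)"
proof -
  have "((\<lambda>x. (- \<i> * of_real t) ^ j * cis (- (t * x)) * char M t) has_vector_derivative
      (- \<i> * of_real t) ^ j * ((- \<i> * of_real t) * cis (- (t * x))) * char M t) (at x)"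
    by (intro has_vector_derivative_mult_left has_vector_derivative_mult_right
        cis_neg_mult_has_vector_derivative)
  from DERIV_cdivide[OF has_field_derivative_Re[OF this]]
  show ?thesis by (simp add: inversion_integrand_def mult_ac)
qed

context
  fixes k :: nat
  assumes decay: "\<And>j. j \<le> k \<Longrightarrow> integrable lborel (\<lambda>t. \<bar>t\<bar> ^ j * norm (char M t))"
begin

lemma inversion_integrand_integrable:
  assumes "j \<le> k" shows "integrable lborel (inversion_integrand j x)"
  by (rule Bochner_Integration.integrable_bound[OF decay[OF assms]])
    (use inversion_integrand_bound in \<open>auto intro!: AE_I2\<close>)

lemma inversion_integral_deriv:
  assumes "j < k"
  shows "(inversion_integral j has_real_derivative inversion_integral (Suc j) x) (at x)"
  unfolding inversion_integral_def[abs_def]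
  by (rule DERIV_under_integral(2)[where G = "\<lambda>t. \<bar>t\<bar> ^ Suc j * norm (char M t)" and ?x0.0 = 0])
    (use assms in \<open>auto intro!: inversion_integrand_deriv inversion_integrand_bound decay
      inversion_integrand_integrable simp del: power_Suc\<close>)

lemma continuous_on_inversion_integral:
  assumes "j \<le> k" shows "continuous_on UNIV (inversion_integral j)"
  unfolding inversion_integral_def[abs_def]
proof (rule continuous_on_parametric_integral[OF _ _ inversion_integrand_bound decay[OF assms]])
  show "continuous_on UNIV (\<lambda>x. inversion_integrand j x t)" for t
    using DERIV_isCont[OF inversion_integrand_deriv] by (auto intro: continuous_at_imp_continuous_on)
qed measurable

lemma inversion_integral_C_k: "C_k k (inversion_integral 0)"
proof -
  have "(deriv ^^ j) (inversion_integral 0) = inversion_integral j" if "j \<le> k" for j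
    using that
  proof (induction j)
    case (Suc j)
    then show ?case using inversion_integral_deriv[of j] by (auto simp: DERIV_imp_deriv)
  qed simp
  then show ?thesis
    using inversion_integral_deriv continuous_on_inversion_integral[of k]
    unfolding C_k_def by (auto intro: differentiableI simp: real_differentiable_def)
qed

text \<open>The kernel of the Levy inversion formula with left end point 0. As a function of \<open>x\<close> it is a primitive
of the inversion integrand, except at \<open>t = 0\<close>, where the division by zero makes it vanish.\<close>

definition cdf_integrand :: "real \<Rightarrow> real \<Rightarrow> real" where
  "cdf_integrand x t = Re ((1 - cis (- (t * x))) / (\<i> * of_real t) * char M t) / (2 * pi)"

definition inversion_cdf :: "real \<Rightarrow> real" where
  "inversion_cdf x = (\<integral>t. cdf_integrand x t \<partial>lborel)"

lemma cdf_integrand_measurable [measurable]: "cdf_integrand x \<in> borel_measurable borel"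
proof -
  have [measurable]: "(\<lambda>t. cis (- (t * x))) \<in> borel_measurable borel"
    by (intro borel_measurable_continuous_onI continuous_intros)
  show ?thesis unfolding cdf_integrand_def[abs_def] by measurable
qed

lemma cdf_integrand_deriv:
  "((\<lambda>x. cdf_integrand x t) has_real_derivative (if t = 0 then 0 else inversion_integrand 0 x t)) (at x)"
proof (cases "t = 0")
  case False
  have "((\<lambda>x. (1 - cis (- (t * x))) / (\<i> * of_real t) * char M t) has_vector_derivative
      (0 - (- \<i> * of_real t) * cis (- (t * x))) / (\<i> * of_real t) * char M t) (at x)"
    by (intro has_vector_derivative_mult_left has_vector_derivative_divide has_vector_derivative_diff
        has_vector_derivative_const cis_neg_mult_has_vector_derivative)
  also have "(0 - (- \<i> * of_real t) * cis (- (t * x))) / (\<i> * of_real t) * char M t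
      = cis (- (t * x)) * char M t"
    using False by simp
  finally have D: "((\<lambda>x. (1 - cis (- (t * x))) / (\<i> * of_real t) * char M t) has_vector_derivative
      cis (- (t * x)) * char M t) (at x)" .
  from DERIV_cdivide[OF has_field_derivative_Re[OF D], of "2 * pi"] False
  show ?thesis by (simp add: cdf_integrand_def inversion_integrand_def)
qed (simp add: cdf_integrand_def)

lemma inversion_cdf_deriv:
  shows "integrable lborel (cdf_integrand x)"
    and "(inversion_cdf has_real_derivative inversion_integral 0 x) (at x)"
proof -
  let ?f' = "\<lambda>x t. if t = 0 then 0 else inversion_integrand 0 x t"
  have 1: "integrable lborel (cdf_integrand x)"
      "((\<lambda>x. \<integral>t. cdf_integrand x t \<partial>lborel) has_real_derivative (\<integral>t. ?f' x t \<partial>lborel)) (at x)" for x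
  proof -
    have b: "\<bar>?f' x t\<bar> \<le> \<bar>t\<bar> ^ 0 * norm (char M t)" for x t
      using inversion_integrand_bound[of 0 x t] by simp
    have m: "?f' x \<in> borel_measurable lborel" "cdf_integrand x \<in> borel_measurable lborel" for x
      by measurable
    have z: "integrable lborel (cdf_integrand 0)" by (simp add: cdf_integrand_def[abs_def])
    show "integrable lborel (cdf_integrand x)"
      "((\<lambda>x. \<integral>t. cdf_integrand x t \<partial>lborel) has_real_derivative (\<integral>t. ?f' x t \<partial>lborel)) (at x)"
      using DERIV_under_integral[OF m(2) m(1) cdf_integrand_deriv b decay[OF le0] z] by blast+
  qed
  have "AE t in lborel. ?f' x t = inversion_integrand 0 x t"
    using AE_lborel_singleton[of "0::real"] by eventually_elim simp
  then have "(\<integral>t. ?f' x t \<partial>lborel) = inversion_integral 0 x"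
    unfolding inversion_integral_def by (intro integral_cong_AE) measurable
  then show "(inversion_cdf has_real_derivative inversion_integral 0 x) (at x)"
    unfolding inversion_cdf_def[abs_def] using 1(2)[of x] by (simp only:)
  show "integrable lborel (cdf_integrand x)" by (rule 1(1))
qed

text \<open>The Levy inversion formula, where the principal value is an absolutely convergent integral because
the characteristic function is integrable.\<close>

lemma measure_Ioc_continuity_points:
  assumes "a \<le> b" "measure M {a} = 0" "measure M {b} = 0"
  shows "measure M {a<..b} = inversion_cdf b - inversion_cdf a"
proof -
  let ?F = "\<lambda>t. (iexp (-(t * a)) - iexp (-(t * b))) / (\<i> * t) * char M t"
  have re: "Re (?F t) / (2 * pi) = cdf_integrand b t - cdf_integrand a t" for t
    by (simp add: cdf_integrand_def cis_conv_exp diff_divide_distrib[symmetric] left_diff_distrib[symmetric]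
        flip: minus_complex.sel)
  let ?D = "\<lambda>t. cdf_integrand b t - cdf_integrand a t"
  have int: "integrable lborel ?D" by (intro Bochner_Integration.integrable_diff inversion_cdf_deriv)
  have "(\<lambda>T. Re (1 / (2 * pi) * (CLBINT t=-real T..real T. ?F t))) \<longlonglongrightarrow> measure M {a<..b}"
    using tendsto_Re[OF Levy_Inversion[OF assms]] by simp
  moreover have "Re (1 / (2 * pi) * (CLBINT t=-real T..real T. ?F t))
      = (LINT t|lborel. indicator {-real T..real T} t * ?D t)" for T
  proof -
    have meas: "?F \<in> borel_measurable borel" by measurable
    have bnd: "norm (?F t) \<le> b - a" for t
    proof (cases "t = 0")
      case False
      have "norm ((iexp (-(t * a)) - iexp (-(t * b))) / (\<i> * t)) \<le> b - a"
        using Levy_Inversion_aux2[of "a" "b" "-t"] assms(1) False by (simp add: norm_divide norm_minus_commute)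
      moreover have "norm (char M t) \<le> 1" by (rule cmod_char_le_1)
      ultimately show ?thesis using mult_mono[of "norm ((iexp (-(t * a)) - iexp (-(t * b))) / (\<i> * t))" "b - a" "norm (char M t)" 1]
        assms(1) by (simp only: norm_mult) simp
    qed (use assms in simp)
    have si: "set_integrable lborel {-real T..real T} ?F"
      unfolding set_integrable_def
    proof (rule integrableI_bounded_set_indicator[where B = "b - a"])
      show "AE x in lborel. x \<in> {-real T..real T} \<longrightarrow> norm (?F x) \<le> b - a" using bnd by simp
    qed (use meas in auto)
    have "(CLBINT t=-real T..real T. ?F t) = (CLINT t:{-real T..real T}|lborel. ?F t)"
      using interval_integral_Icc[of "-real T" "real T" ?F] by simp
    then have "Re (CLBINT t=-real T..real T. ?F t) = (LINT t|lborel. Re (indicator {-real T..real T} t *\<^sub>R ?F t))"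
      using si unfolding set_lebesgue_integral_def set_integrable_def by (simp only: integral_Re)
    then have "Re (1 / (2 * pi) * (CLBINT t=-real T..real T. ?F t))
        = (LINT t|lborel. Re (indicator {-real T..real T} t *\<^sub>R ?F t)) / (2 * pi)"
      by simp
    also have "\<dots> = (LINT t|lborel. indicator {-real T..real T} t * (Re (?F t) / (2 * pi)))"
      by (subst integral_divide_zero[symmetric]) simp
    finally show ?thesis unfolding re .
  qed
  moreover have "(\<lambda>T. LINT t|lborel. indicator {-real T..real T} t * ?D t) \<longlonglongrightarrow> (LINT t|lborel. ?D t)"
  proof (rule integral_dominated_convergence[where w = "\<lambda>t. norm (?D t)"])
    show "integrable lborel (\<lambda>t. norm (?D t))" using int by simp
    show "AE t in lborel. (\<lambda>T. indicator {-real T..real T} t * ?D t) \<longlonglongrightarrow> ?D t"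
    proof (intro AE_I2)
      fix t :: real
      have "eventually (\<lambda>T. indicator {-real T..real T} t * ?D t = ?D t) sequentially"
        using eventually_ge_at_top[of "nat \<lceil>\<bar>t\<bar>\<rceil>"]
        by eventually_elim (auto simp: indicator_def nat_le_iff ceiling_le_iff)
      then show "(\<lambda>T. indicator {-real T..real T} t * ?D t) \<longlonglongrightarrow> ?D t"
        by (rule tendsto_eventually)
    qed
    show "AE t in lborel. norm (indicator {-real T..real T} t * ?D t) \<le> norm (?D t)" for T
      by (intro AE_I2) (auto simp: indicator_def)
  qed measurable
  ultimately have "measure M {a<..b} = (LINT t|lborel. ?D t)"
    using LIMSEQ_unique by simp
  then show ?thesis by (simp add: inversion_cdf_def inversion_cdf_deriv(1))
qed

text \<open>The difference of both functions is constant off the countable set of atoms and continuous from the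
right, and every right neighbourhood contains points that are not atoms.\<close>

lemma inversion_cdf_diff: "cdf M x - inversion_cdf x = cdf M y - inversion_cdf y"
proof -
  let ?D = "\<lambda>x. cdf M x - inversion_cdf x"
  define S where "S = {x. measure M {x} > 0}"
  have S: "countable S" unfolding S_def by (rule countable_atoms)
  have eq: "?D a = ?D b" if "a \<notin> S" "b \<notin> S" for a b
  proof -
    have m: "measure M {a} = 0" "measure M {b} = 0"
      using that measure_nonneg[of M "{a}"] measure_nonneg[of M "{b}"] by (auto simp: S_def)
    consider "a < b" | "b < a" | "a = b" by linarith
    then show ?thesis
    proof cases
      case 1
      then show ?thesis using measure_Ioc_continuity_points[OF _ m] cdf_diff_eq[OF 1] by simp
    next
      case 2
      then show ?thesis using measure_Ioc_continuity_points[OF _ m(2,1)] cdf_diff_eq[OF 2] by simp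
    qed simp
  qed
  obtain c where c: "c \<notin> S" using open_minus_countable[OF S, of UNIV] by auto
  have "?D x = ?D c" for x
  proof -
    have "isCont inversion_cdf x" using inversion_cdf_deriv(2) by (rule DERIV_isCont)
    then have lim: "(?D \<longlongrightarrow> ?D x) (at_right x)"
      using cdf_is_right_cont[of x] unfolding continuous_within isCont_def
      by (intro tendsto_diff) (auto intro: filterlim_mono[OF _ order_refl at_le])
    have "\<exists>\<^sub>F y in at_right x. ?D y = ?D c"
      unfolding frequently_def eventually_at_right_field
    proof safe
      fix b assume b: "x < b" "\<forall>y>x. y < b \<longrightarrow> ?D y \<noteq> ?D c"
      obtain y where "y \<in> {x<..<b}" "y \<notin> S" using open_minus_countable[OF S, of "{x<..<b}"] b(1) by auto
      then show False using b(2) eq[of y c] c by auto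
    qed
    show ?thesis
    proof (rule ccontr)
      assume ne: "?D x \<noteq> ?D c"
      from tendsto_imp_eventually_ne[OF lim ne] have "eventually (\<lambda>y. ?D y \<noteq> ?D c) (at_right x)" .
      with \<open>\<exists>\<^sub>F y in at_right x. ?D y = ?D c\<close> show False by (simp add: frequently_def)
    qed
  qed
  then show ?thesis by metis
qed

lemma inversion_integral_nonneg: "inversion_integral 0 x \<ge> 0"
proof -
  have "mono inversion_cdf"
  proof (rule monoI)
    fix x y :: real assume "x \<le> y"
    then have "cdf M x \<le> cdf M y" by (rule cdf_nondecreasing)
    then show "inversion_cdf x \<le> inversion_cdf y" using inversion_cdf_diff[of x y] by linarith
  qed
  then have "mono_on UNIV inversion_cdf" by simp
  then show ?thesis using mono_on_imp_deriv_nonneg[OF _ inversion_cdf_deriv(2)] by simp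
qed

text \<open>A differentiable distribution function determines the measure of every half-line through the
fundamental theorem of calculus, and half-lines determine the measure.\<close>

lemma inversion_integral_density: "M = density lborel (\<lambda>x. ennreal (inversion_integral 0 x))"
proof (rule measure_eqI_lessThan)
  have meas: "inversion_integral 0 \<in> borel_measurable borel"
    by (intro borel_measurable_continuous_onI continuous_on_inversion_integral) simp
  have lim: "(inversion_cdf \<longlongrightarrow> 1 - (cdf M 0 - inversion_cdf 0)) at_top"
  proof -
    have "inversion_cdf = (\<lambda>x. cdf M x - (cdf M 0 - inversion_cdf 0))"
      using inversion_cdf_diff[of _ 0] by (auto simp: fun_eq_iff algebra_simps)
    then show ?thesis using tendsto_diff[OF cdf_lim_at_top_prob tendsto_const] by metis
  qed
  fix x :: real
  have "emeasure (density lborel (\<lambda>x. ennreal (inversion_integral 0 x))) {x<..}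
      = (\<integral>\<^sup>+u. ennreal (inversion_integral 0 u) * indicator {x<..} u \<partial>lborel)"
    using meas by (subst emeasure_density) auto
  also have "\<dots> = (\<integral>\<^sup>+u. ennreal (inversion_integral 0 u) * indicator {x..} u \<partial>lborel)"
    by (rule nn_integral_cong_AE) (use AE_lborel_singleton[of x] in \<open>auto elim!: eventually_mono simp: indicator_def\<close>)
  also have "\<dots> = ennreal (1 - (cdf M 0 - inversion_cdf 0) - inversion_cdf x)"
    by (rule nn_integral_FTC_atLeast[OF meas inversion_cdf_deriv(2) inversion_integral_nonneg lim])
  also have "1 - (cdf M 0 - inversion_cdf 0) - inversion_cdf x = 1 - cdf M x"
    using inversion_cdf_diff[of x 0] by simp
  also have "\<dots> = measure M {x<..}"
  proof -
    have "{x<..} = space M - {..x}" by auto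
    then show ?thesis using prob_compl[of "{..x}"] by (simp add: cdf_def)
  qed
  finally show "emeasure M {x<..} = emeasure (density lborel (\<lambda>x. ennreal (inversion_integral 0 x))) {x<..}"
    by (simp add: emeasure_eq_measure)
  show "emeasure M {x<..} < \<infinity>" by (simp add: emeasure_eq_measure)
qed auto

end

end

section \<open>Local times\<close>

lemma osc_integral_eq_cis: "osc_integral W n t = integral {0..1} (\<lambda>\<theta>. cis (2 * pi * n * \<theta>) * cis (t * W \<theta>))"
  unfolding osc_integral_def cis_conv_exp by (simp add: mult_ac)

lemma osc_sup_bigo:
  assumes "\<And>n t. \<bar>t\<bar> \<ge> T \<Longrightarrow> norm (osc_integral W n t) \<le> A * \<bar>t\<bar> powr e"
  shows "osc_sup W \<in> O[at_infinity](\<lambda>t. \<bar>t\<bar> powr e)"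
proof (rule bigoI)
  have "norm (osc_sup W t) \<le> A * norm (\<bar>t\<bar> powr e)" if t: "T \<le> norm t" for t
  proof -
    have le: "norm (osc_integral W n t) \<le> A * \<bar>t\<bar> powr e" for n using assms t by simp
    have "osc_sup W t \<le> A * \<bar>t\<bar> powr e"
      unfolding osc_sup_def by (rule cSUP_least) (use le in auto)
    moreover have "norm (osc_integral W 0 t) \<le> osc_sup W t"
      unfolding osc_sup_def by (rule cSUP_upper) (use le in \<open>auto intro!: bdd_aboveI\<close>)
    then have "0 \<le> osc_sup W t" using norm_ge_zero order_trans by blast
    ultimately show ?thesis by simp
  qed
  then show "eventually (\<lambda>t. norm (osc_sup W t) \<le> A * norm (\<bar>t\<bar> powr e)) at_infinity"
    unfolding eventually_at_infinity by blast
qed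

lemma real_distribution_occupation_measure:
  assumes "continuous_on UNIV W"
  shows "real_distribution (occupation_measure W)"
proof -
  have W: "W \<in> borel_measurable (restrict_space lborel {0..<1})"
    using borel_measurable_continuous_onI[OF assms] by (intro measurable_restrict_space1) simp
  have "prob_space (restrict_space lborel {0..<1::real})"
    by (intro prob_spaceI) (simp add: emeasure_restrict_space space_restrict_space)
  then have "prob_space (occupation_measure W)"
    unfolding occupation_measure_def using W by (rule prob_space.prob_space_distr)
  then show ?thesis
    unfolding real_distribution_def real_distribution_axioms_def by (simp add: occupation_measure_def)
qed

lemma char_occupation_measure:
  assumes "continuous_on UNIV W"
  shows "char (occupation_measure W) t = osc_integral W 0 t"
proof -
  have W[measurable]: "W \<in> borel_measurable borel" by (rule borel_measurable_continuous_onI[OF assms])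
  have W': "W \<in> borel_measurable (restrict_space lborel {0..<1})"
    using W by (intro measurable_restrict_space1) simp
  have "char (occupation_measure W) t = (CLINT \<theta>|restrict_space lborel {0..<1}. iexp (t * W \<theta>))"
    unfolding char_def occupation_measure_def using W' by (intro integral_distr) auto
  also have "\<dots> = (CLINT \<theta>:{0..<1}|lborel. iexp (t * W \<theta>))"
    unfolding set_lebesgue_integral_def by (intro integral_restrict_space) simp
  also have "\<dots> = (CLINT \<theta>:{0..1}|lborel. iexp (t * W \<theta>))"
    by (rule set_integral_discrete_difference[where X = "{1}"]) auto
  also have "\<dots> = integral {0..1} (\<lambda>\<theta>. iexp (t * W \<theta>))"
    by (intro set_borel_integral_eq_integral borel_integrable_atLeastAtMost'
        continuous_intros continuous_on_subset[OF assms]) auto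
  also have "\<dots> = osc_integral W 0 t" by (simp add: osc_integral_def mult_ac)
  finally show ?thesis .
qed

text \<open>With exponent \<open>2 (k + 1) \<ge> k + 2\<close> the functions \<open>\<bar>t\<bar> ^ j\<close> times the characteristic function, for
\<open>j \<le> k\<close>, are dominated by a multiple of \<open>1 / (1 + t\<^sup>2)\<close>: for large \<open>\<bar>t\<bar>\<close> by the decay, for the rest
because characteristic functions are bounded by 1.\<close>

lemma has_C_k_local_time_of_decay:
  assumes W: "continuous_on UNIV W"
    and decay: "\<And>t. \<bar>t\<bar> \<ge> T \<Longrightarrow> norm (osc_integral W 0 t) \<le> A * \<bar>t\<bar> powr (- e)"
    and e: "e \<ge> 2 * (real k + 1)"
  shows "has_C_k_local_time k W"
proof -
  interpret real_distribution "occupation_measure W" by (rule real_distribution_occupation_measure[OF W])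
  let ?c = "char (occupation_measure W)"
  define S where "S = max 1 T"
  define B where "B = 2 * \<bar>A\<bar> + S ^ k * (1 + S\<^sup>2)"
  have S: "S \<ge> 1" "S \<ge> T" by (auto simp: S_def)
  have B0: "B \<ge> 0" using S by (simp add: B_def)
  have c_le: "norm (?c t) \<le> \<bar>A\<bar> * \<bar>t\<bar> powr (- e)" if "\<bar>t\<bar> \<ge> S" for t
    using decay[of t] that S mult_right_mono[OF abs_ge_self[of A], of "\<bar>t\<bar> powr (- e)"]
    by (simp add: char_occupation_measure[OF W])
  have bound: "\<bar>t\<bar> ^ j * norm (?c t) \<le> B * inverse (1 + t\<^sup>2)" if j: "j \<le> k" for j t
  proof (cases "\<bar>t\<bar> \<ge> S")
    case True
    then have t: "\<bar>t\<bar> \<ge> 1" using S by simp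
    have "\<bar>t\<bar> ^ j * norm (?c t) \<le> \<bar>t\<bar> ^ k * (\<bar>A\<bar> * \<bar>t\<bar> powr (- (2 * real k + 2)))"
    proof (intro mult_mono power_increasing j t)
      have "\<bar>t\<bar> powr (- e) \<le> \<bar>t\<bar> powr (- (2 * real k + 2))" using t e by (intro powr_mono) auto
      then show "norm (?c t) \<le> \<bar>A\<bar> * \<bar>t\<bar> powr (- (2 * real k + 2))"
        using c_le[OF True] by (meson abs_ge_zero mult_left_mono order_trans)
    qed auto
    also have "\<dots> = \<bar>A\<bar> * \<bar>t\<bar> powr (- real k - 2)"
      using t by (simp add: powr_realpow[symmetric] powr_add[symmetric])
    also have "\<dots> \<le> \<bar>A\<bar> * \<bar>t\<bar> powr (- 2)" using t by (intro mult_left_mono powr_mono) auto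
    also have "\<bar>t\<bar> powr (- 2) = 1 / t\<^sup>2" using t by (simp add: powr_minus_divide)
    also have "\<bar>A\<bar> * (1 / t\<^sup>2) \<le> \<bar>A\<bar> * (2 * inverse (1 + t\<^sup>2))"
    proof (rule mult_left_mono)
      show "1 / t\<^sup>2 \<le> 2 * inverse (1 + t\<^sup>2)"
        using t one_le_power[OF t, of 2] by (simp add: field_simps)
    qed simp
    also have "\<dots> = 2 * \<bar>A\<bar> * inverse (1 + t\<^sup>2)" by simp
    also have "\<dots> \<le> B * inverse (1 + t\<^sup>2)"
      using S by (intro mult_right_mono) (auto simp: B_def add_nonneg_nonneg)
    finally show ?thesis .
  next
    case False
    then have t: "\<bar>t\<bar> \<le> S" by simp
    have "\<bar>t\<bar> ^ j * norm (?c t) \<le> S ^ k * 1"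
      using t S j by (intro mult_mono cmod_char_le_1 order_trans[OF power_mono power_increasing]) auto
    also have "\<dots> \<le> S ^ k * ((1 + S\<^sup>2) * inverse (1 + t\<^sup>2))"
    proof (intro mult_left_mono)
      have "t\<^sup>2 \<le> S\<^sup>2" using power_mono[OF t, of 2] by simp
      then show "1 \<le> (1 + S\<^sup>2) * inverse (1 + t\<^sup>2)"
        by (simp add: divide_inverse[symmetric] pos_le_divide_eq add_pos_nonneg)
    qed (use S in auto)
    also have "\<dots> \<le> B * inverse (1 + t\<^sup>2)"
      unfolding mult.assoc[symmetric] by (intro mult_right_mono) (auto simp: B_def)
    finally show ?thesis .
  qed
  have int: "integrable lborel (\<lambda>t. \<bar>t\<bar> ^ j * norm (?c t))" if "j \<le> k" for j
  proof (rule Bochner_Integration.integrable_bound)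
    show "integrable lborel (\<lambda>t. B * inverse (1 + t\<^sup>2))"
      using integrable_inverse_1_plus_square by (simp add: set_integrable_def)
    show "AE t in lborel. norm (\<bar>t\<bar> ^ j * norm (?c t)) \<le> norm (B * inverse (1 + t\<^sup>2))"
      using bound[OF that] B0 by (intro AE_I2) (simp add: abs_mult)
  qed measurable
  have "is_local_time W (inversion_integral 0)"
    unfolding is_local_time_def
    using inversion_integral_density[OF int] inversion_integral_nonneg[OF int]
      continuous_on_inversion_integral[OF int, of k 0]
    by (auto intro: borel_measurable_continuous_onI)
  then show ?thesis
    using inversion_integral_C_k[OF int] unfolding has_C_k_local_time_def by blast
qed

text \<open>The exponent provided by the oscillatory estimate is halved. The decay of \<open>osc_sup\<close> survives this
trivially, and at the smallest admissible \<open>b\<close> for \<open>C_k k\<close> the integral of mode 0 still decays with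
exponent \<open>2 (k + 1)\<close>.\<close>

lemma weierstrass_decay_and_local_time:
  fixes \<phi> :: "real \<Rightarrow> real"
  assumes an: "real_analytic \<phi>" and per: "\<And>x. \<phi> (x + 1) = \<phi> x" and nc: "\<not> \<phi> constant_on UNIV"
  shows "\<exists>c>0. \<forall>\<mu>::real. 0 < \<mu> \<and> \<mu> < 1 \<longrightarrow>
        (\<exists>b\<^sub>0::real. b\<^sub>0 \<ge> 2 \<and>
          (\<forall>b::nat. real b \<ge> b\<^sub>0 \<longrightarrow>
            osc_sup (weierstrass \<phi> \<mu> b) \<in>
              O[at_infinity](\<lambda>t. \<bar>t\<bar> powr (- c * (ln (real b) / \<bar>ln \<mu>\<bar>)))) \<and>
          (\<forall>k::nat. \<forall>b::nat. real b \<ge> max b\<^sub>0 (exp ((real k + 1) * \<bar>ln \<mu>\<bar> / c)) \<longrightarrow>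
            has_C_k_local_time k (weierstrass \<phi> \<mu> b)))"
proof -
  have cont: "continuous_on UNIV \<phi>"
    using real_analytic_derivative(1)[OF an] by (auto intro!: continuous_at_imp_continuous_on DERIV_isCont)
  obtain c where c: "c > 0" and main: "\<And>\<mu>. 0 < \<mu> \<Longrightarrow> \<mu> < 1 \<Longrightarrow> \<exists>b\<^sub>0\<ge>2. \<forall>b::nat. real b \<ge> b\<^sub>0 \<longrightarrow>
    (\<exists>A. \<forall>\<nu> t. \<bar>t\<bar> \<ge> real b ^ 2 \<longrightarrow>
      norm (integral {0..1} (\<lambda>x. cis (\<nu> * x) * cis (t * weierstrass \<phi> \<mu> b x)))
        \<le> A * \<bar>t\<bar> powr (- c * (ln (real b) / \<bar>ln \<mu>\<bar>)))"
    using weierstrass_oscillatory_decay[OF an per nc] by blast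
  have "\<exists>b\<^sub>0::real. b\<^sub>0 \<ge> 2 \<and>
          (\<forall>b::nat. real b \<ge> b\<^sub>0 \<longrightarrow>
            osc_sup (weierstrass \<phi> \<mu> b) \<in>
              O[at_infinity](\<lambda>t. \<bar>t\<bar> powr (- (c / 2) * (ln (real b) / \<bar>ln \<mu>\<bar>)))) \<and>
          (\<forall>k::nat. \<forall>b::nat. real b \<ge> max b\<^sub>0 (exp ((real k + 1) * \<bar>ln \<mu>\<bar> / (c / 2))) \<longrightarrow>
            has_C_k_local_time k (weierstrass \<phi> \<mu> b))" if \<mu>: "0 < \<mu>" "\<mu> < 1" for \<mu>
  proof -
    obtain b0 where b0: "b0 \<ge> 2" and dec: "\<And>b::nat. real b \<ge> b0 \<Longrightarrow> \<exists>A. \<forall>\<nu> t. \<bar>t\<bar> \<ge> real b ^ 2 \<longrightarrow>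
      norm (integral {0..1} (\<lambda>x. cis (\<nu> * x) * cis (t * weierstrass \<phi> \<mu> b x)))
        \<le> A * \<bar>t\<bar> powr (- c * (ln (real b) / \<bar>ln \<mu>\<bar>))"
      using main[OF \<mu>] by blast
    have L: "\<bar>ln \<mu>\<bar> > 0" using \<mu> by auto
    have osc: "\<exists>A. \<forall>n t. \<bar>t\<bar> \<ge> real b ^ 2 \<longrightarrow> norm (osc_integral (weierstrass \<phi> \<mu> b) n t)
        \<le> A * \<bar>t\<bar> powr (- (c * (ln (real b) / \<bar>ln \<mu>\<bar>)))" if b: "real b \<ge> b0" for b :: nat
    proof -
      obtain A where "\<And>\<nu> t. \<bar>t\<bar> \<ge> real b ^ 2 \<Longrightarrow>
        norm (integral {0..1} (\<lambda>x. cis (\<nu> * x) * cis (t * weierstrass \<phi> \<mu> b x)))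
          \<le> A * \<bar>t\<bar> powr (- c * (ln (real b) / \<bar>ln \<mu>\<bar>))"
        using dec[OF b] by blast
      then show ?thesis
        unfolding osc_integral_eq_cis mult_minus_left by (intro exI[of _ A] allI impI)
    qed
    show ?thesis
    proof (intro exI[of _ b0] conjI b0 allI impI)
      fix b :: nat assume b: "real b \<ge> b0"
      obtain A where A: "\<And>n t. \<bar>t\<bar> \<ge> real b ^ 2 \<Longrightarrow> norm (osc_integral (weierstrass \<phi> \<mu> b) n t)
        \<le> A * \<bar>t\<bar> powr (- (c * (ln (real b) / \<bar>ln \<mu>\<bar>)))" using osc[OF b] by blast
      show "osc_sup (weierstrass \<phi> \<mu> b) \<in>
              O[at_infinity](\<lambda>t. \<bar>t\<bar> powr (- (c / 2) * (ln (real b) / \<bar>ln \<mu>\<bar>)))"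
      proof (rule osc_sup_bigo)
        fix n and t :: real assume t: "\<bar>t\<bar> \<ge> real b ^ 2"
        have "real b ^ 2 \<ge> 1" using b b0 by (intro one_le_power) linarith
        then have t1: "\<bar>t\<bar> \<ge> 1" using t by linarith
        have "0 \<le> c * (ln (real b) / \<bar>ln \<mu>\<bar>)" using c L b b0 by simp
        moreover have "- (c * y) \<le> - (c / 2) * y" if "0 \<le> c * y" for y
          using that by simp
        ultimately have "- (c * (ln (real b) / \<bar>ln \<mu>\<bar>)) \<le> - (c / 2) * (ln (real b) / \<bar>ln \<mu>\<bar>)"
          by blast
        then have "\<bar>t\<bar> powr (- (c * (ln (real b) / \<bar>ln \<mu>\<bar>))) \<le> \<bar>t\<bar> powr (- (c / 2) * (ln (real b) / \<bar>ln \<mu>\<bar>))"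
          using t1 by (rule powr_mono)
        then have "\<bar>A\<bar> * \<bar>t\<bar> powr (- (c * (ln (real b) / \<bar>ln \<mu>\<bar>))) \<le> \<bar>A\<bar> * \<bar>t\<bar> powr (- (c / 2) * (ln (real b) / \<bar>ln \<mu>\<bar>))"
          by (rule mult_left_mono) simp
        moreover have "A * \<bar>t\<bar> powr (- (c * (ln (real b) / \<bar>ln \<mu>\<bar>))) \<le> \<bar>A\<bar> * \<bar>t\<bar> powr (- (c * (ln (real b) / \<bar>ln \<mu>\<bar>)))"
          by (intro mult_right_mono) auto
        ultimately show "norm (osc_integral (weierstrass \<phi> \<mu> b) n t)
            \<le> \<bar>A\<bar> * \<bar>t\<bar> powr (- (c / 2) * (ln (real b) / \<bar>ln \<mu>\<bar>))"
          using A[OF t, of n] by linarith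
      qed
    next
      fix k b :: nat assume b: "real b \<ge> max b0 (exp ((real k + 1) * \<bar>ln \<mu>\<bar> / (c / 2)))"
      obtain A where A: "\<And>n t. \<bar>t\<bar> \<ge> real b ^ 2 \<Longrightarrow> norm (osc_integral (weierstrass \<phi> \<mu> b) n t)
        \<le> A * \<bar>t\<bar> powr (- (c * (ln (real b) / \<bar>ln \<mu>\<bar>)))" using osc[of b] b by auto
      have "(real k + 1) * \<bar>ln \<mu>\<bar> / (c / 2) \<le> ln (real b)"
        using b b0 by (subst ln_ge_iff) auto
      then have "2 * (real k + 1) \<le> c * (ln (real b) / \<bar>ln \<mu>\<bar>)"
        using c L by (simp add: field_simps)
      then show "has_C_k_local_time k (weierstrass \<phi> \<mu> b)"
        by (intro has_C_k_local_time_of_decay[OF weierstrass_continuous[OF per cont \<mu>] A])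
    qed
  qed
  then show ?thesis using c by (intro exI[of _ "c / 2"]) auto
qed

lemma real_analytic_sin_cos:
  fixes a :: real
  shows "real_analytic (\<lambda>\<theta>. sin (a * \<theta>))" and "real_analytic (\<lambda>\<theta>. cos (a * \<theta>))"
proof -
  show "real_analytic (\<lambda>\<theta>. sin (a * \<theta>))"
    unfolding real_analytic_def distrib_left sin_add
    by (intro allI exI) (rule fps_expansion_intros)+
  show "real_analytic (\<lambda>\<theta>. cos (a * \<theta>))"
    unfolding real_analytic_def distrib_left cos_add
    by (intro allI exI) (rule fps_expansion_intros)+
qed

lemma sin_cos_admissible:
  assumes "\<phi> \<in> {\<lambda>\<theta>::real. sin (2 * pi * \<theta>), \<lambda>\<theta>. cos (2 * pi * \<theta>)}"
  shows "real_analytic \<phi>" "\<And>\<theta>. \<phi> (\<theta> + 1) = \<phi> \<theta>" "\<not> \<phi> constant_on UNIV"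
proof -
  show "real_analytic \<phi>" using assms real_analytic_sin_cos[of "2 * pi"] by auto
  show "\<phi> (\<theta> + 1) = \<phi> \<theta>" for \<theta>
    using assms by (auto simp: distrib_left sin_add cos_add)
  have "\<phi> 0 \<noteq> \<phi> (1 / 4) \<or> \<phi> 0 \<noteq> \<phi> (1/2)" using assms by (auto simp: sin_pi_half)
  then show "\<not> \<phi> constant_on UNIV" unfolding constant_on_def by (metis UNIV_I)
qed

lemma eventually_sequentially_ge_real:
  "(\<And>b::nat. real b \<ge> B \<Longrightarrow> P b) \<Longrightarrow> \<forall>\<^sub>F b in sequentially. P b"
  using eventually_ge_at_top[of "nat \<lceil>B\<rceil>"] by eventually_elim (simp add: nat_le_iff ceiling_le_iff)

theorem corollary1p5:
  shows "(\<forall>\<phi> :: real \<Rightarrow> real.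
      real_analytic \<phi> \<and> (\<forall>\<theta>. \<phi> (\<theta> + 1) = \<phi> \<theta>) \<and> \<not> \<phi> constant_on UNIV \<longrightarrow>
      (\<exists>c>0. \<forall>\<mu>::real. 0 < \<mu> \<and> \<mu> < 1 \<longrightarrow>
        (\<exists>b\<^sub>0::real. b\<^sub>0 \<ge> 2 \<and>
          (\<forall>b::nat. real b \<ge> b\<^sub>0 \<longrightarrow>
            osc_sup (weierstrass \<phi> \<mu> b) \<in>
              O[at_infinity](\<lambda>t. \<bar>t\<bar> powr (- c * (ln (real b) / \<bar>ln \<mu>\<bar>)))) \<and>
          (\<forall>k::nat. \<forall>b::nat. real b \<ge> max b\<^sub>0 (exp ((real k + 1) * \<bar>ln \<mu>\<bar> / c)) \<longrightarrow>
            has_C_k_local_time k (weierstrass \<phi> \<mu> b)))))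
    \<and>
    (\<forall>\<phi> \<in> {\<lambda>\<theta>::real. sin (2 * pi * \<theta>), \<lambda>\<theta>. cos (2 * pi * \<theta>)}.
      real_analytic \<phi> \<and> (\<forall>\<theta>. \<phi> (\<theta> + 1) = \<phi> \<theta>) \<and> \<not> \<phi> constant_on UNIV \<and>
      (\<exists>c>0. \<forall>\<mu>::real. 0 < \<mu> \<and> \<mu> < 1 \<longrightarrow>
        (\<forall>\<^sub>F b in sequentially.
            osc_sup (weierstrass \<phi> \<mu> b) \<in>
              O[at_infinity](\<lambda>t. \<bar>t\<bar> powr (- c * (ln (real b) / \<bar>ln \<mu>\<bar>)))) \<and>
        (\<forall>k::nat. \<forall>\<^sub>F b in sequentially. has_C_k_local_time k (weierstrass \<phi> \<mu> b))))"
    (is "?general \<and> ?classical")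
proof
  show ?general using weierstrass_decay_and_local_time by blast
  show ?classical
  proof (intro ballI conjI)
    fix \<phi> :: "real \<Rightarrow> real" assume \<phi>: "\<phi> \<in> {\<lambda>\<theta>::real. sin (2 * pi * \<theta>), \<lambda>\<theta>. cos (2 * pi * \<theta>)}"
    note adm = sin_cos_admissible[OF \<phi>]
    show "real_analytic \<phi>" "\<forall>\<theta>. \<phi> (\<theta> + 1) = \<phi> \<theta>" "\<not> \<phi> constant_on UNIV" using adm by auto
    show "\<exists>c>0. \<forall>\<mu>::real. 0 < \<mu> \<and> \<mu> < 1 \<longrightarrow>
        (\<forall>\<^sub>F b in sequentially.
            osc_sup (weierstrass \<phi> \<mu> b) \<in>
              O[at_infinity](\<lambda>t. \<bar>t\<bar> powr (- c * (ln (real b) / \<bar>ln \<mu>\<bar>)))) \<and>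
        (\<forall>k::nat. \<forall>\<^sub>F b in sequentially. has_C_k_local_time k (weierstrass \<phi> \<mu> b))"
      using weierstrass_decay_and_local_time[OF adm] by (meson eventually_sequentially_ge_real)
  qed
qed

end
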